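(* There exists an absolute constant $C>1$ such that the following holds. Let $1\le m\le n$ be integers, let $\mu$ be a nonzero measure on $\mathbb{R}^n$ with bounded, even, quasi-concave density $\phi\colon\mathbb{R}^n\to[0,\infty)$, and let $H\subset\mathbb{R}^n$ be an $m$-dimensional linear subspace. Then for any convex body $K\subset\mathbb{R}^n$, $$1\le\left[\frac{\mu((K-K)\cap H)}{\sup_{y\in\mathbb{R}^n}\mu((K-y)\cap H)}\right]^{\frac1m}\le\binom{n+m}{m}^{\frac1m}\le C\cdot\frac nm.$$
   Context: A convex body is a compact convex subset of $\mathbb{R}^n$ with non-empty interior; $K-K=\{a-b:a,b\in K\}$. A function $\phi\ge0$ is quasi-concave if $\phi((1-\lambda)x+\lambda y)\ge\min\{\phi(x),\phi(y)\}$ for all $x,y\in\mathbb{R}^n$, $\lambda\in[0,1]$. If $\mu$ has (Borel) density $\phi$ and $H$ is a linear subspace, then $\mu(A\cap H)=\int_H\phi(x)\chi_A(x)\,dx$ with $dx$ Lebesgue measure on $H$. *)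

theory Defs
  imports "HOL-Analysis.Analysis" "HOL-Analysis.Finite_Function_Topology"
begin

text \<open>
  The constant of the theorem must not depend on the dimension, so all the spaces \<open>\<real>\<^sup>n\<close> live
  in one type: \<open>Rn n\<close> is the space of finitely supported real sequences with support in
  \<open>{0,\<dots>,n-1}\<close>. The library equips this type with the \<open>l\<^sup>1\<close> norm; on \<open>Rn n\<close>
  it induces the usual topology and the usual Borel sets. Notions that depend on the Euclidean
  structure, that is orthonormality and hence Lebesgue measure, use \<open>dot\<close> and not that norm.
\<close>

type_synonym rvec = "nat \<Rightarrow>\<^sub>0 real"

definition Rn :: "nat \<Rightarrow> rvec set"
  where "Rn n = {x. Poly_Mapping.keys x \<subseteq> {..<n}}"

definition dot :: "rvec \<Rightarrow> rvec \<Rightarrow> real"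
  where "dot x y = (\<Sum>i\<in>Poly_Mapping.keys x. Poly_Mapping.lookup x i * Poly_Mapping.lookup y i)"

definition orthonormal_basis :: "rvec set \<Rightarrow> rvec set \<Rightarrow> bool"
  where "orthonormal_basis H B \<longleftrightarrow>
    (\<forall>b\<in>B. \<forall>c\<in>B. dot b c = (if b = c then 1 else 0)) \<and> span B = H"

text \<open>
  Lebesgue measure on a finite-dimensional subspace \<open>H\<close>, defined as the library defines
  \<open>lborel\<close>, with an orthonormal basis of \<open>H\<close> in place of \<open>Basis\<close>. By rotation
  invariance it does not depend on the basis chosen.
\<close>

definition lborel_subspace :: "rvec set \<Rightarrow> rvec measure"
  where "lborel_subspace H =
    (let B = (SOME B. orthonormal_basis H B) in
      distr (\<Pi>\<^sub>M b\<in>B. lborel) (restrict_space borel H) (\<lambda>f. \<Sum>b\<in>B. f b *\<^sub>R b))"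

text \<open>
  The measure on \<open>H\<close> with density \<open>\<phi>\<close> restricted to \<open>H\<close>. For \<open>H = Rn n\<close> this
  is the measure \<open>\<mu>\<close> on \<open>\<real>\<^sup>n\<close> with density \<open>\<phi>\<close>.
\<close>

definition measure_with_density :: "(rvec \<Rightarrow> real) \<Rightarrow> rvec set \<Rightarrow> rvec measure"
  where "measure_with_density \<phi> H = density (lborel_subspace H) (\<lambda>x. ennreal (\<phi> x))"

definition section_measure :: "(rvec \<Rightarrow> real) \<Rightarrow> rvec set \<Rightarrow> rvec set \<Rightarrow> ennreal"
  where "section_measure \<phi> H A = (\<integral>\<^sup>+x. ennreal (\<phi> x) * indicator A x \<partial>lborel_subspace H)"

definition quasi_concave_on :: "rvec set \<Rightarrow> (rvec \<Rightarrow> real) \<Rightarrow> bool"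
  where "quasi_concave_on S \<phi> \<longleftrightarrow>
    (\<forall>x\<in>S. 0 \<le> \<phi> x) \<and>
    (\<forall>x\<in>S. \<forall>y\<in>S. \<forall>t\<in>{0..1}. \<phi> ((1 - t) *\<^sub>R x + t *\<^sub>R y) \<ge> min (\<phi> x) (\<phi> y))"

definition convex_body :: "nat \<Rightarrow> rvec set \<Rightarrow> bool"
  where "convex_body n K \<longleftrightarrow>
    K \<subseteq> Rn n \<and> compact K \<and> convex K \<and> top_of_set (Rn n) interior_of K \<noteq> {}"

definition difference_body :: "rvec set \<Rightarrow> rvec set"
  where "difference_body K = {a - b | a b. a \<in> K \<and> b \<in> K}"

text \<open>
  The quotient is formed in \<open>[0,\<infinity>]\<close>, where \<open>a / 0 = \<infinity>\<close> for \<open>a > 0\<close>,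
  \<open>0 / 0 = 0\<close> and \<open>\<infinity> / \<infinity> = 0\<close>, and \<open>enn2real \<infinity> = 0\<close>. So if a
  denominator is \<open>0\<close> or \<open>\<infinity>\<close>, or the numerator is \<open>\<infinity>\<close>, the value is
  \<open>0\<close>; a lower bound by \<open>1\<close> thus includes that both are finite and positive.
\<close>

definition section_ratio :: "nat \<Rightarrow> (rvec \<Rightarrow> real) \<Rightarrow> rvec set \<Rightarrow> rvec set \<Rightarrow> real"
  where "section_ratio n \<phi> H K = enn2real
    (section_measure \<phi> H (difference_body K) /
      (SUP y\<in>Rn n. section_measure \<phi> H ((\<lambda>x. x - y) ` K)))"

end

(*
  Lower bound: if A is a convex section of a translate of K and L is a superlevel set of phi on H,
  the midpoint of u in A \<inter> L and -v with v in A \<inter> L lies in (K - K) \<inter> L, because L is symmetric and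
  convex. The Prekopa-Leindler inequality for indicators gives |A \<inter> L| \<le> |(K - K) \<inter> L|, and one
  integrates over the levels. (Applying it to phi directly would need log-concavity.)

  Upper bound (Rogers-Shephard): integrate g(x) = |K \<inter> (K - x)| over H against mu. By Fubini the integral
  is at most |K| times the supremum of the sections. Conversely K \<inter> (K - t(a - b)) contains
  (1 - t)K + t b, so g \<ge> (1 - t)^n |K| on t(K - K); since phi(t x) \<ge> phi(x), the set t(K - K) \<inter> H has
  measure at least t^m mu((K - K) \<inter> H), and the integral of n (1 - t)^(n-1) t^m over [0,1] is the
  reciprocal of the binomial coefficient.
*)
theory Submission
  imports Defs
begin

section \<open>The Prekopa--Leindler inequality for midpoints\<close>

text \<open>Two dimensions compete in the upper bound: the volume of K is taken in R^n, so shrinking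
  K costs (1 - t)^n, while the mass of a section is taken in H, so dilating it costs only t^m. This
  mismatch gives (n+m choose m). When m < n, H is Lebesgue-null in R^n, so a nonzero mu says nothing
  directly about H. Convexity repairs this: the set where phi > 0 is symmetric, convex and not null,
  so its dilates fill R^n and it reaches into every direction of H. The quotient must be a genuine
  one. The numerator is finite because K - K is bounded, and positive by the previous remark; the
  supremum is finite by the lower bound and positive by the upper bound. The multiplicative
  Prekopa-Leindler inequality contains no dimension, so it passes from one coordinate to many by
  induction. Nothing is lost against an additive form, because the second set is the reflection of
  the first and the left side becomes a square.\<close>

lemma emeasure_lborel_le_by_initial_parts:
  fixes A :: "real set"
  assumes A[measurable]: "A \<in> sets borel" and "A \<noteq> {}"
    and le: "\<And>a. a \<in> A \<Longrightarrow> emeasure lborel (A \<inter> {..a}) + Z \<le> Y"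
  shows "emeasure lborel A + Z \<le> Y"
proof -
  \<comment> \<open>\<open>A\<close> need not have a maximum, so cut-offs \<open>r n\<close> climb
    towards its supremum (or to infinity), each lying below some point of \<open>A\<close> where
    \<open>le\<close> applies. Only the supremum itself, if it belongs to \<open>A\<close>, can
    escape all of them; it is the null point \<open>s\<close>.\<close>
  obtain r :: "nat \<Rightarrow> real" and s where r: "incseq r" "\<And>n. \<exists>a\<in>A. r n \<le> a"
    "\<And>x. x \<in> A \<Longrightarrow> x \<noteq> s \<Longrightarrow> \<exists>n. x \<le> r n"
  proof (cases "bdd_above A")
    case True
    define r where "r = (\<lambda>n. Sup A - 1 / real (Suc n))"
    show thesis
    proof (rule that[of r "Sup A"])
      show "incseq r"
        by (auto simp: r_def incseq_def intro!: divide_left_mono)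
      show "\<exists>a\<in>A. r n \<le> a" for n
      proof -
        have "r n < Sup A" by (simp add: r_def)
        then show ?thesis using less_cSupD[OF \<open>A \<noteq> {}\<close>] by (meson less_imp_le)
      qed
      show "\<exists>n. x \<le> r n" if "x \<in> A" "x \<noteq> Sup A" for x
      proof -
        have "x < Sup A"
          using that True cSup_upper[of x A] by auto
        then obtain n where "1 / real (Suc n) < Sup A - x"
          using nat_approx_posE[of "Sup A - x"] by auto
        then show ?thesis by (intro exI[of _ n]) (simp add: r_def)
      qed
    qed
  next
    case False
    show thesis
    proof (rule that[of real])
      show "\<exists>a\<in>A. real n \<le> a" for n
        using False by (meson bdd_above.I linear)
      show "\<exists>n. x \<le> real n" for x
        by (rule real_arch_simple)
    qed (simp add: incseq_def)
  qed
  have "emeasure lborel A \<le> emeasure lborel ((\<Union>n. A \<inter> {..r n}) \<union> {s})"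
    using r(3) by (intro emeasure_mono) auto
  also have "\<dots> \<le> emeasure lborel (\<Union>n. A \<inter> {..r n}) + emeasure lborel {s}"
    by (intro emeasure_subadditive) auto
  also have "\<dots> = (SUP n. emeasure lborel (A \<inter> {..r n}))"
    using r(1) by (subst SUP_emeasure_incseq[symmetric]) (auto simp: incseq_def intro: order_trans)
  finally have "emeasure lborel A + Z \<le> (SUP n. emeasure lborel (A \<inter> {..r n})) + Z"
    by (rule add_right_mono)
  also have "\<dots> = (SUP n. emeasure lborel (A \<inter> {..r n}) + Z)"
    by (simp add: ennreal_SUP_add_left)
  also have "\<dots> \<le> Y"
  proof (rule SUP_least)
    fix n
    obtain a where "a \<in> A" "r n \<le> a" using r(2) by blast
    then have "emeasure lborel (A \<inter> {..r n}) + Z \<le> emeasure lborel (A \<inter> {..a}) + Z"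
      by (intro add_right_mono emeasure_mono) auto
    also have "\<dots> \<le> Y" using le \<open>a \<in> A\<close> .
    finally show "emeasure lborel (A \<inter> {..r n}) + Z \<le> Y" .
  qed
  finally show ?thesis .
qed

lemma emeasure_lborel_affine_le:
  fixes A C :: "real set"
  assumes [measurable]: "A \<in> sets borel" "C \<in> sets borel" and "c \<noteq> 0"
    and sub: "\<And>x. x \<in> A \<Longrightarrow> t + c * x \<in> C"
  shows "ennreal \<bar>c\<bar> * emeasure lborel A \<le> emeasure lborel C"
proof -
  have "\<bar>c\<bar> * emeasure lborel A = \<bar>c\<bar> * (\<integral>\<^sup>+x. indicator A x \<partial>lborel)" by simp
  also have "\<dots> \<le> \<bar>c\<bar> * (\<integral>\<^sup>+x. indicator C (t + c * x) \<partial>lborel)"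
    using sub by (intro mult_left_mono nn_integral_mono) (auto simp: indicator_def)
  also have "\<dots> = (\<integral>\<^sup>+x. indicator C x \<partial>lborel)"
    by (rule nn_integral_real_affine[symmetric]) (use \<open>c \<noteq> 0\<close> in auto)
  finally show ?thesis by simp
qed

lemma brunn_minkowski_midpoint_real:
  fixes A B C :: "real set"
  assumes [measurable]: "A \<in> sets borel" "B \<in> sets borel" "C \<in> sets borel"
    and "A \<noteq> {}" "B \<noteq> {}"
    and mid: "\<And>a b. a \<in> A \<Longrightarrow> b \<in> B \<Longrightarrow> (a + b) / 2 \<in> C"
  shows "emeasure lborel A + emeasure lborel B \<le> 2 * emeasure lborel C"
proof -
  \<comment> \<open>The halves \<open>(A \<inter> {..a} + b) / 2\<close> and \<open>(a + B \<inter> {b..}) / 2\<close> of \<open>C\<close> meet only in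
    \<open>(a + b) / 2\<close>; reflecting \<open>B\<close> to \<open>D\<close> lets the same exhaustion argument treat \<open>a\<close> and \<open>b\<close>.\<close>
  define D where "D = {x. - x \<in> B}"
  have D[measurable]: "D \<in> sets borel"
    unfolding D_def by measurable
  have parts: "emeasure lborel (A \<inter> {..a}) + emeasure lborel (D \<inter> {..d}) \<le> 2 * emeasure lborel C"
    if "a \<in> A" "d \<in> D" for a d
  proof -
        define c where "c = (a + - d) / 2"
    have le: "ennreal (1/2) * emeasure lborel (A \<inter> {..a}) \<le> emeasure lborel (C \<inter> {..c})"
    proof -
      have "- d / 2 + 1 / 2 * x \<in> C \<inter> {..c}" if "x \<in> A \<inter> {..a}" for x
        using mid[of x "- d"] that \<open>d \<in> D\<close> by (auto simp: D_def c_def field_simps)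
      from emeasure_lborel_affine_le[of "A \<inter> {..a}" "C \<inter> {..c}" "1 / 2" "- d / 2", OF _ _ _ this]
      show ?thesis by simp
    qed
    have le': "ennreal (1/2) * emeasure lborel (D \<inter> {..d}) \<le> emeasure lborel (C \<inter> {c..})"
    proof -
      have "a / 2 + (- 1 / 2) * x \<in> C \<inter> {c..}" if "x \<in> D \<inter> {..d}" for x
        using mid[of a "- x"] that \<open>a \<in> A\<close> by (auto simp: D_def c_def field_simps)
      from emeasure_lborel_affine_le[of "D \<inter> {..d}" "C \<inter> {c..}" "- 1 / 2" "a / 2", OF _ _ _ this]
      show ?thesis by simp
    qed
    \<comment> \<open>Dropping the null point \<open>c\<close> from the right half makes the two
      halves disjoint, so their measures add up to that of \<open>C\<close>.\<close>
    have "emeasure lborel (C \<inter> {c..}) \<le> emeasure lborel (C \<inter> {c<..} \<union> {c})"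
      by (intro emeasure_mono) auto
    also have "\<dots> \<le> emeasure lborel (C \<inter> {c<..}) + emeasure lborel {c}"
      by (intro emeasure_subadditive) auto
    finally have le'': "emeasure lborel (C \<inter> {c..}) \<le> emeasure lborel (C \<inter> {c<..})" by simp
    have "emeasure lborel (C \<inter> {..c}) + emeasure lborel (C \<inter> {c<..}) = emeasure lborel C"
      by (subst plus_emeasure) (auto intro!: arg_cong[where f = "emeasure lborel"])
    then have "ennreal (1/2) * (emeasure lborel (A \<inter> {..a}) + emeasure lborel (D \<inter> {..d})) \<le> emeasure lborel C"
      using add_mono[OF le order_trans[OF le' le'']] by (simp add: distrib_left)
    then have "2 * (ennreal (1/2) * (emeasure lborel (A \<inter> {..a}) + emeasure lborel (D \<inter> {..d}))) \<le> 2 * emeasure lborel C"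
      by (rule mult_left_mono) simp
    moreover have "2 * (ennreal (1/2) * u) = u" for u
    proof -
      have "ennreal 2 * ennreal (1/2) = ennreal (2 * (1/2))"
        by (rule ennreal_mult[symmetric]) auto
      also have "\<dots> = 1" by simp
      finally have "2 * ennreal (1/2) = 1" by (simp only: ennreal_numeral)
      then show ?thesis by (metis mult.assoc mult_1)
    qed
    ultimately show ?thesis by simp
  qed
  have "emeasure lborel A + emeasure lborel (D \<inter> {..d}) \<le> 2 * emeasure lborel C" if "d \<in> D" for d
    by (rule emeasure_lborel_le_by_initial_parts[OF assms(1,4) parts[OF _ that]])
  then have DA: "emeasure lborel (D \<inter> {..d}) + emeasure lborel A \<le> 2 * emeasure lborel C" if "d \<in> D" for d
    using that by (subst add.commute)
  have "D \<noteq> {}"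
  proof -
    obtain b where "b \<in> B" using \<open>B \<noteq> {}\<close> by blast
    then have "- b \<in> D" by (simp add: D_def)
    then show ?thesis by blast
  qed
  then have "emeasure lborel D + emeasure lborel A \<le> 2 * emeasure lborel C"
    by (rule emeasure_lborel_le_by_initial_parts[OF D _ DA])
  moreover have "emeasure lborel B \<le> emeasure lborel D"
    using emeasure_lborel_affine_le[of B D "-1" 0] by (auto simp: D_def)
  ultimately show ?thesis
    by (metis add.commute add_left_mono order_trans)
qed

text \<open>Layer cake with the levels rescaled to (0,1): functions with different caps can then be
  compared at the same parameter \<open>t\<close>. The minimum with \<open>c\<close> cuts off
  exactly the levels above 1.\<close>

lemma nn_integral_min_layers:
  fixes h :: "real \<Rightarrow> ennreal"
  assumes [measurable]: "h \<in> borel_measurable borel" and "c > 0"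
  shows "(\<integral>\<^sup>+x. min (h x) (ennreal c) \<partial>lborel) =
    ennreal c * (\<integral>\<^sup>+t. indicator {0<..<1} t * emeasure lborel {x. ennreal (c * t) < h x} \<partial>lborel)"
proof -
  have pt: "min (h x) (ennreal c) =
      (\<integral>\<^sup>+t. ennreal c * (indicator {0<..<1} t * indicator {x. ennreal (c * t) < h x} x) \<partial>lborel)" for x
  proof -
    define u where "u = min (h x) (ennreal c)"
    have "u \<noteq> top" by (auto simp: u_def min_def top_unique)
    then obtain v where v: "u = ennreal v" "v \<ge> 0" by (cases u) auto
    have "v \<le> c" using v \<open>c > 0\<close> by (metis u_def min.cobounded2 ennreal_le_iff less_imp_le)
    have iff: "ennreal (c * t) < h x \<longleftrightarrow> c * t < v" if "0 < t" "t < 1" for t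
    proof -
      have "ennreal (c * t) < ennreal c" using that \<open>c > 0\<close> by (intro ennreal_lessI) auto
      then have "ennreal (c * t) < h x \<longleftrightarrow> ennreal (c * t) < u" by (auto simp: u_def)
      also have "\<dots> \<longleftrightarrow> c * t < v" using v that \<open>c > 0\<close> by (simp add: ennreal_less_iff)
      finally show ?thesis .
    qed
    have "indicator {0<..<1} t * indicator {x. ennreal (c * t) < h x} x =
        (indicator {0<..<v / c} t :: ennreal)" for t
    proof -
      have "0 < t \<and> t < 1 \<and> ennreal (c * t) < h x \<longleftrightarrow> 0 < t \<and> t < v / c"
      proof (cases "0 < t \<and> t < 1")
        case True
        then show ?thesis using iff[of t] \<open>c > 0\<close> by (simp add: field_simps)
      next
        case False
        have "v / c \<le> 1" using \<open>c > 0\<close> \<open>v \<le> c\<close> by simp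
        with False show ?thesis by linarith
      qed
      then show ?thesis by (auto simp: indicator_def)
    qed
    then have "(\<integral>\<^sup>+t. ennreal c * (indicator {0<..<1} t * indicator {x. ennreal (c * t) < h x} x) \<partial>lborel)
       = ennreal c * ennreal (v / c)"
      using v \<open>c > 0\<close> by (simp add: nn_integral_cmult)
    also have "\<dots> = ennreal v" using v \<open>c > 0\<close> by (simp flip: ennreal_mult)
    finally show ?thesis using v u_def by simp
  qed
  have "(\<integral>\<^sup>+x. min (h x) (ennreal c) \<partial>lborel) =
    (\<integral>\<^sup>+x. (\<integral>\<^sup>+t. ennreal c * (indicator {0<..<1} t * indicator {x. ennreal (c * t) < h x} x) \<partial>lborel) \<partial>lborel)"
    by (simp only: pt)
  also have "\<dots> = (\<integral>\<^sup>+t. (\<integral>\<^sup>+x. ennreal c * (indicator {0<..<1} t * indicator {x. ennreal (c * t) < h x} x) \<partial>lborel) \<partial>lborel)"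
    by (rule lborel_pair.Fubini') measurable
  also have "\<dots> = (\<integral>\<^sup>+t. ennreal c * (indicator {0<..<1} t * emeasure lborel {x. ennreal (c * t) < h x}) \<partial>lborel)"
    by (simp add: nn_integral_cmult)
  also have "\<dots> = ennreal c * (\<integral>\<^sup>+t. indicator {0<..<1} t * emeasure lborel {x. ennreal (c * t) < h x} \<partial>lborel)"
    by (rule nn_integral_cmult) measurable
  finally show ?thesis .
qed

text \<open>The arithmetic-geometric mean inequality: (bF + aG)^2 exceeds 4ab FG by the square (bF -
  aG)^2.\<close>

lemma ennreal_prod_le_square:
  fixes F G H :: ennreal
  assumes a: "a > 0" and b: "b > 0"
    and le: "ennreal b * F + ennreal a * G \<le> 2 * ennreal (sqrt (a * b)) * H"
  shows "F * G \<le> H\<^sup>2"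
proof (cases "H = top")
  case False
  have "2 * ennreal (sqrt (a * b)) * H \<noteq> top"
    using False by (simp add: ennreal_mult_eq_top_iff)
  then have "ennreal b * F + ennreal a * G \<noteq> top"
    using le by (auto simp: top_unique)
  then have "F \<noteq> top" "G \<noteq> top"
    using a b by (auto simp: ennreal_mult_eq_top_iff)
  with False obtain x y z where [simp]: "F = ennreal x" "G = ennreal y" "H = ennreal z"
    and pos: "x \<ge> 0" "y \<ge> 0" "z \<ge> 0"
    by (metis ennreal_cases)
  define s where "s = sqrt (a * b)"
  have s: "s > 0" "s\<^sup>2 = a * b" using a b by (auto simp: s_def)
  have "ennreal (b * x + a * y) \<le> ennreal (2 * s * z)"
    using le a b pos s(1) by (simp add: s_def ennreal_mult ennreal_plus flip: ennreal_numeral)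
  then have "b * x + a * y \<le> 2 * s * z"
    using pos s by (subst (asm) ennreal_le_iff) auto
  moreover have "0 \<le> b * x + a * y" using a b pos by simp
  ultimately have "(b * x + a * y)\<^sup>2 \<le> (2 * s * z)\<^sup>2"
    by (rule power_mono)
  then have "4 * (a * b) * (x * y) + (b * x - a * y)\<^sup>2 \<le> 4 * (a * b) * z\<^sup>2"
    using s(2) by (simp add: power_mult_distrib) (simp add: power2_eq_square algebra_simps)
  then have "4 * (a * b) * (x * y) \<le> 4 * (a * b) * z\<^sup>2"
    by (smt (verit) zero_le_power2)
  then have "x * y \<le> z\<^sup>2" using a b by (simp add: mult_le_cancel_left_pos)
  then show ?thesis using pos by (simp add: ennreal_power flip: ennreal_mult)
qed simp

text \<open>The one-dimensional Brunn-Minkowski inequality needs nonempty sets. Measuring the levels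
  of \<open>f\<close> and \<open>g\<close> relative to their suprema \<open>a\<close> and
  \<open>b\<close> ensures this for every t < 1; boundedness makes both suprema finite.\<close>

lemma prekopa_leindler_real_bounded:
  fixes f g h :: "real \<Rightarrow> ennreal"
  assumes [measurable]: "f \<in> borel_measurable borel" "g \<in> borel_measurable borel" "h \<in> borel_measurable borel"
    and bdd: "\<And>x. f x \<le> ennreal k" "\<And>x. g x \<le> ennreal k"
    and mid: "\<And>x y. f x * g y \<le> (h ((x + y) / 2))\<^sup>2"
  shows "(\<integral>\<^sup>+x. f x \<partial>lborel) * (\<integral>\<^sup>+x. g x \<partial>lborel) \<le> (\<integral>\<^sup>+x. h x \<partial>lborel)\<^sup>2"
proof (cases "(SUP x. f x) = 0 \<or> (SUP x. g x) = 0")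
  case True
  then have "(\<forall>x. f x = 0) \<or> (\<forall>x. g x = 0)" by (simp add: SUP_eq_iff bot_ennreal[symmetric])
  then show ?thesis by auto
next
  case False
  have "(SUP x. f x) \<le> ennreal k" "(SUP x. g x) \<le> ennreal k"
    using bdd by (auto intro: SUP_least)
  then have "(SUP x. f x) \<noteq> top" "(SUP x. g x) \<noteq> top"
    by (metis ennreal_neq_top top_unique)+
  then obtain a b where ab: "(SUP x. f x) = ennreal a" "(SUP x. g x) = ennreal b" "a \<ge> 0" "b \<ge> 0"
    by (metis ennreal_cases)
  have pos: "a > 0" "b > 0" using False ab by (auto simp: less_le)
  \<comment> \<open>If f x > a t and g y > b t, the product exceeds (c t)^2; so \<open>c\<close> is
    the scale on which the levels of \<open>h\<close> have to be read.\<close>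
  define c where "c = sqrt (a * b)"
  have c: "c > 0" "c\<^sup>2 = a * b" using pos by (auto simp: c_def)
  define F G H where "F = (\<lambda>t. emeasure lborel {x. ennreal (a * t) < f x})"
    and "G = (\<lambda>t. emeasure lborel {x. ennreal (b * t) < g x})"
    and "H = (\<lambda>t. emeasure lborel {x. ennreal (c * t) < h x})"
  have [measurable]: "F \<in> borel_measurable borel" "G \<in> borel_measurable borel" "H \<in> borel_measurable borel"
    unfolding F_def G_def H_def by measurable
  have level: "F t + G t \<le> 2 * H t" if t: "0 < t" "t < 1" for t
    unfolding F_def G_def H_def
  proof (rule brunn_minkowski_midpoint_real)
    have "ennreal (a * t) < (SUP x. f x)" "ennreal (b * t) < (SUP x. g x)"
      using t pos by (auto simp: ab ennreal_less_iff)
    then show "{x. ennreal (a * t) < f x} \<noteq> {}" "{x. ennreal (b * t) < g x} \<noteq> {}"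
      by (auto simp: less_SUP_iff)
    fix x y assume "x \<in> {x. ennreal (a * t) < f x}" "y \<in> {x. ennreal (b * t) < g x}"
    then have xy: "ennreal (a * t) < f x" "ennreal (b * t) < g y" by auto
    obtain u v where uv: "f x = ennreal u" "g y = ennreal v" "u \<ge> 0" "v \<ge> 0"
      using bdd(1)[of x] bdd(2)[of y] by (metis ennreal_cases ennreal_neq_top top_unique)
    have "a * t < u" "b * t < v" using xy uv pos t by (auto simp: ennreal_less_iff)
    then have "(a * t) * (b * t) < u * v"
      using pos t by (intro mult_strict_mono') auto
    then have lt: "(c * t)\<^sup>2 < u * v" using c by (simp add: power_mult_distrib) (simp add: power2_eq_square mult_ac)
    have "ennreal (c * t) < h ((x + y) / 2)"
    proof (rule ccontr)
      assume "\<not> ennreal (c * t) < h ((x + y) / 2)"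
      then have "(h ((x + y) / 2))\<^sup>2 \<le> (ennreal (c * t))\<^sup>2" by (intro power_mono) auto
      also have "\<dots> = ennreal ((c * t)\<^sup>2)" using c t by (simp add: ennreal_power)
      also have "\<dots> < f x * g y" using lt uv c t by (simp add: ennreal_less_iff flip: ennreal_mult)
      finally show False using mid[of x y] by simp
    qed
    then show "(x + y) / 2 \<in> {x. ennreal (c * t) < h x}" by simp
  qed measurable
  have f: "(\<integral>\<^sup>+x. f x \<partial>lborel) = ennreal a * (\<integral>\<^sup>+t. indicator {0<..<1} t * F t \<partial>lborel)"
  proof -
    have "min (f x) (ennreal a) = f x" for x
      using SUP_upper[of x UNIV f] by (simp add: ab min_def)
    then show ?thesis using nn_integral_min_layers[of f a] pos by (simp add: F_def)
  qed
  have g: "(\<integral>\<^sup>+x. g x \<partial>lborel) = ennreal b * (\<integral>\<^sup>+t. indicator {0<..<1} t * G t \<partial>lborel)"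
  proof -
    have "min (g x) (ennreal b) = g x" for x
      using SUP_upper[of x UNIV g] by (simp add: ab min_def)
    then show ?thesis using nn_integral_min_layers[of g b] pos by (simp add: G_def)
  qed
  have h: "ennreal c * (\<integral>\<^sup>+t. indicator {0<..<1} t * H t \<partial>lborel) \<le> (\<integral>\<^sup>+x. h x \<partial>lborel)"
    unfolding H_def by (subst nn_integral_min_layers[symmetric]) (auto intro!: nn_integral_mono c)
  \<comment> \<open>The weights \<open>b\<close> and \<open>a\<close> give both layer integrals the
    common factor a b = c^2. One factor \<open>c\<close> is absorbed by the integral of
    \<open>h\<close>, the other remains, as the mean inequality requires.\<close>
  have "ennreal b * (\<integral>\<^sup>+x. f x \<partial>lborel) + ennreal a * (\<integral>\<^sup>+x. g x \<partial>lborel)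
      = ennreal (a * b) * ((\<integral>\<^sup>+t. indicator {0<..<1} t * F t \<partial>lborel) + (\<integral>\<^sup>+t. indicator {0<..<1} t * G t \<partial>lborel))"
    using pos by (simp add: f g ennreal_mult mult_ac distrib_left)
  also have "\<dots> = ennreal (a * b) * (\<integral>\<^sup>+t. indicator {0<..<1} t * F t + indicator {0<..<1} t * G t \<partial>lborel)"
    by (subst nn_integral_add) auto
  also have "\<dots> \<le> ennreal (a * b) * (\<integral>\<^sup>+t. 2 * (indicator {0<..<1} t * H t) \<partial>lborel)"
    using level by (intro mult_left_mono nn_integral_mono) (auto simp: indicator_def)
  also have "\<dots> = 2 * ennreal c * (ennreal c * (\<integral>\<^sup>+t. indicator {0<..<1} t * H t \<partial>lborel))"
    using c by (subst nn_integral_cmult)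
      (auto simp: power2_eq_square ennreal_mult mult_ac simp flip: c(2))
  also have "\<dots> \<le> 2 * ennreal c * (\<integral>\<^sup>+x. h x \<partial>lborel)"
    by (intro mult_left_mono h) auto
  finally show ?thesis
    using pos unfolding c_def by (intro ennreal_prod_le_square[of a b])
qed

lemma SUP_min_of_nat_ennreal: "(SUP k. min x (of_nat k)) = (x :: ennreal)"
proof (cases "x = top")
  case True
  then show ?thesis by (simp add: ennreal_SUP_of_nat_eq_top)
next
  case False
  then obtain k where "x \<le> of_nat k"
    using ennreal_Ex_less_of_nat[of x] less_imp_le by (metis less_top)
  then show ?thesis
    by (intro antisym SUP_least) (auto intro!: SUP_upper2[of k])
qed

text \<open>Truncating \<open>f\<close> and \<open>g\<close> preserves the midpoint hypothesis with
  the same \<open>h\<close>, so monotone convergence removes the bound.\<close>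

lemma prekopa_leindler_real:
  fixes f g h :: "real \<Rightarrow> ennreal"
  assumes [measurable]: "f \<in> borel_measurable borel" "g \<in> borel_measurable borel" "h \<in> borel_measurable borel"
    and mid: "\<And>x y. f x * g y \<le> (h ((x + y) / 2))\<^sup>2"
  shows "(\<integral>\<^sup>+x. f x \<partial>lborel) * (\<integral>\<^sup>+x. g x \<partial>lborel) \<le> (\<integral>\<^sup>+x. h x \<partial>lborel)\<^sup>2"
proof -
  have trunc: "(\<integral>\<^sup>+x. u x \<partial>lborel) = (SUP k. \<integral>\<^sup>+x. min (u x) (of_nat k) \<partial>lborel)"
    if [measurable]: "u \<in> borel_measurable borel" for u :: "real \<Rightarrow> ennreal"
  proof -
    have "(\<integral>\<^sup>+x. u x \<partial>lborel) = (\<integral>\<^sup>+x. (SUP k. min (u x) (of_nat k)) \<partial>lborel)"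
      by (simp only: SUP_min_of_nat_ennreal)
    also have "\<dots> = (SUP k. \<integral>\<^sup>+x. min (u x) (of_nat k) \<partial>lborel)"
      by (rule nn_integral_monotone_convergence_SUP)
        (auto simp: incseq_def le_fun_def intro: min.coboundedI2)
    finally show ?thesis .
  qed
  have "(\<integral>\<^sup>+x. min (f x) (of_nat j) \<partial>lborel) * (\<integral>\<^sup>+x. min (g x) (of_nat k) \<partial>lborel) \<le> (\<integral>\<^sup>+x. h x \<partial>lborel)\<^sup>2" for j k
  proof (rule prekopa_leindler_real_bounded)
    show "min (f x) (of_nat j) \<le> ennreal (real (max j k))" for x
      by (auto simp: ennreal_of_nat_eq_real_of_nat intro!: min.coboundedI2 ennreal_leI)
    show "min (g x) (of_nat k) \<le> ennreal (real (max j k))" for x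
      by (auto simp: ennreal_of_nat_eq_real_of_nat intro!: min.coboundedI2 ennreal_leI)
    show "min (f x) (of_nat j) * min (g y) (of_nat k) \<le> (h ((x + y) / 2))\<^sup>2" for x y
      by (rule order_trans[OF mult_mono mid]) auto
  qed measurable
  then show ?thesis
    by (simp only: trunc[OF assms(1)] trunc[OF assms(2)] SUP_mult_left_ennreal SUP_mult_right_ennreal)
      (intro SUP_least)
qed

section \<open>Prekopa-Leindler and affine substitution on finite products of the real line\<close>

interpretation lborel_product: product_sigma_finite "\<lambda>_ :: 'i. lborel :: real measure"
  by (rule product_sigma_finite.intro) (rule sigma_finite_lborel)

text \<open>Integrate out the inserted coordinate. The one-dimensional inequality on that coordinate
  is exactly the midpoint hypothesis for the marginals, to which the induction hypothesis applies.
  The midpoint is restricted to \<open>I\<close> because points of the product space are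
  \<open>undefined\<close> elsewhere.\<close>

lemma prekopa_leindler_PiM:
  fixes f g h :: "('i \<Rightarrow> real) \<Rightarrow> ennreal"
  assumes "finite I"
    and "f \<in> borel_measurable (\<Pi>\<^sub>M i\<in>I. lborel)" "g \<in> borel_measurable (\<Pi>\<^sub>M i\<in>I. lborel)"
      "h \<in> borel_measurable (\<Pi>\<^sub>M i\<in>I. lborel)"
    and "\<And>x y. x \<in> extensional I \<Longrightarrow> y \<in> extensional I \<Longrightarrow>
      f x * g y \<le> (h (\<lambda>i\<in>I. (x i + y i) / 2))\<^sup>2"
  shows "(\<integral>\<^sup>+x. f x \<partial>(\<Pi>\<^sub>M i\<in>I. lborel)) * (\<integral>\<^sup>+x. g x \<partial>(\<Pi>\<^sub>M i\<in>I. lborel))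
    \<le> (\<integral>\<^sup>+x. h x \<partial>(\<Pi>\<^sub>M i\<in>I. lborel))\<^sup>2"
  using assms
proof (induction I arbitrary: f g h)
  case empty
  show ?case
    using empty(4)[of "\<lambda>_. undefined" "\<lambda>_. undefined"]
    by (simp add: lborel_product.nn_integral_empty restrict_def del: nn_integral_const)
next
  case (insert i I)
  note [measurable] = insert.prems(1-3)
  let ?M = "\<Pi>\<^sub>M i\<in>I. lborel :: real measure"
  have slice: "(\<lambda>t. u (x(i := t))) \<in> borel_measurable borel"
    if [measurable]: "u \<in> borel_measurable (\<Pi>\<^sub>M i\<in>insert i I. lborel)" and x: "x \<in> space ?M"
    for u :: "('i \<Rightarrow> real) \<Rightarrow> ennreal" and x
  proof -
    have "(\<lambda>t. x(i := t)) \<in> measurable lborel (\<Pi>\<^sub>M i\<in>insert i I. lborel)"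
      using measurable_compose[OF measurable_Pair1'[OF x] measurable_add_dim[of i I "\<lambda>_. lborel"]] by simp
    then show ?thesis using measurable_compose[OF _ that(1)] by simp
  qed
  have meas: "(\<lambda>x. \<integral>\<^sup>+t. u (x(i := t)) \<partial>lborel) \<in> borel_measurable ?M"
    if [measurable]: "u \<in> borel_measurable (\<Pi>\<^sub>M i\<in>insert i I. lborel)"
    for u :: "('i \<Rightarrow> real) \<Rightarrow> ennreal"
    by measurable
  have "(\<integral>\<^sup>+x. (\<integral>\<^sup>+t. f (x(i := t)) \<partial>lborel) \<partial>?M) * (\<integral>\<^sup>+x. (\<integral>\<^sup>+t. g (x(i := t)) \<partial>lborel) \<partial>?M)
      \<le> (\<integral>\<^sup>+x. (\<integral>\<^sup>+t. h (x(i := t)) \<partial>lborel) \<partial>?M)\<^sup>2"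
  proof (rule insert.IH)
    fix x y :: "'i \<Rightarrow> real" assume xy: "x \<in> extensional I" "y \<in> extensional I"
    let ?z = "\<lambda>j\<in>I. (x j + y j) / 2"
    have sp: "x \<in> space ?M" "y \<in> space ?M" "?z \<in> space ?M"
      using xy by (auto simp: space_PiM PiE_def)
    show "(\<integral>\<^sup>+t. f (x(i := t)) \<partial>lborel) * (\<integral>\<^sup>+t. g (y(i := t)) \<partial>lborel) \<le> (\<integral>\<^sup>+t. h (?z(i := t)) \<partial>lborel)\<^sup>2"
    proof (rule prekopa_leindler_real)
      fix s t :: real
      have mid: "(\<lambda>j\<in>insert i I. ((x(i := s)) j + (y(i := t)) j) / 2) = ?z(i := (s + t) / 2)"
        using insert.hyps by (auto simp: fun_eq_iff)
      have ext: "x(i := s) \<in> extensional (insert i I)" "y(i := t) \<in> extensional (insert i I)"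
        using xy by (auto simp: extensional_def)
      show "f (x(i := s)) * g (y(i := t)) \<le> (h (?z(i := (s + t) / 2)))\<^sup>2"
        using insert.prems(4)[OF ext] by (simp only: mid)
    qed (use sp in \<open>auto intro!: slice insert.prems\<close>)
  qed (rule meas, fact insert.prems)+
  then show ?case
    using insert.hyps insert.prems(1-3) by (simp add: lborel_product.product_nn_integral_insert)
qed

text \<open>Each coordinate contributes one factor |c|. Translation, reflection and dilation are all
  instances, and all three are used later.\<close>

lemma nn_integral_PiM_affine:
  fixes g :: "('i \<Rightarrow> real) \<Rightarrow> ennreal"
  assumes "finite I" and "g \<in> borel_measurable (\<Pi>\<^sub>M i\<in>I. lborel)" and c: "c \<noteq> 0"
  shows "(\<integral>\<^sup>+x. g x \<partial>(\<Pi>\<^sub>M i\<in>I. lborel)) =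
    ennreal (\<bar>c\<bar> ^ card I) * (\<integral>\<^sup>+x. g (\<lambda>i\<in>I. v i + c * x i) \<partial>(\<Pi>\<^sub>M i\<in>I. lborel))"
  using assms(1,2)
proof (induction I arbitrary: g)
  case empty
  then show ?case by (simp add: lborel_product.nn_integral_empty restrict_def del: nn_integral_const)
next
  case (insert i I)
  note [measurable] = insert.prems(1)
  let ?M = "\<Pi>\<^sub>M i\<in>I. lborel :: real measure"
  have slice: "(\<lambda>t. g (x(i := t))) \<in> borel_measurable borel" if x: "x \<in> space ?M" for x
  proof -
    have "(\<lambda>t. x(i := t)) \<in> measurable lborel (\<Pi>\<^sub>M i\<in>insert i I. lborel)"
      using measurable_compose[OF measurable_Pair1'[OF x] measurable_add_dim[of i I "\<lambda>_. lborel"]] by simp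
    then show ?thesis using measurable_compose[OF _ insert.prems(1)] by simp
  qed
  have restr: "(\<lambda>j\<in>I. v j + c * x j) \<in> space ?M" for x
    by (auto simp: space_PiM)
  have meas: "(\<lambda>x. g (\<lambda>j\<in>insert i I. v j + c * x j)) \<in> borel_measurable (\<Pi>\<^sub>M i\<in>insert i I. lborel)"
    by measurable
  have upd: "(\<lambda>j\<in>insert i I. v j + c * (x(i := t)) j) = (\<lambda>j\<in>I. v j + c * x j)(i := v i + c * t)" for x t
    using insert.hyps by (auto simp: fun_eq_iff)
  have "(\<integral>\<^sup>+x. g x \<partial>(\<Pi>\<^sub>M i\<in>insert i I. lborel)) = (\<integral>\<^sup>+x. (\<integral>\<^sup>+t. g (x(i := t)) \<partial>lborel) \<partial>?M)"
    using insert by (simp add: lborel_product.product_nn_integral_insert)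
  also have "\<dots> = ennreal (\<bar>c\<bar> ^ card I) * (\<integral>\<^sup>+x. (\<integral>\<^sup>+t. g ((\<lambda>j\<in>I. v j + c * x j)(i := t)) \<partial>lborel) \<partial>?M)"
    by (rule insert.IH) measurable
  also have "\<dots> = ennreal (\<bar>c\<bar> ^ card I) * (\<integral>\<^sup>+x. ennreal \<bar>c\<bar> * (\<integral>\<^sup>+t. g ((\<lambda>j\<in>I. v j + c * x j)(i := v i + c * t)) \<partial>lborel) \<partial>?M)"
    by (subst nn_integral_real_affine[where c = c, OF slice[OF restr] c]) (rule refl)
  also have "\<dots> = ennreal (\<bar>c\<bar> ^ card I) * (ennreal \<bar>c\<bar> * (\<integral>\<^sup>+x. (\<integral>\<^sup>+t. g (\<lambda>j\<in>insert i I. v j + c * (x(i := t)) j) \<partial>lborel) \<partial>?M))"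
    unfolding upd[symmetric]
    by (subst nn_integral_cmult) measurable
  also have "\<dots> = ennreal (\<bar>c\<bar> ^ card I) * (ennreal \<bar>c\<bar> * (\<integral>\<^sup>+x. g (\<lambda>j\<in>insert i I. v j + c * x j) \<partial>(\<Pi>\<^sub>M i\<in>insert i I. lborel)))"
    using insert.hyps by (subst lborel_product.product_nn_integral_insert[OF _ _ meas]) auto
  also have "\<dots> = ennreal (\<bar>c\<bar> ^ card (insert i I)) * (\<integral>\<^sup>+x. g (\<lambda>j\<in>insert i I. v j + c * x j) \<partial>(\<Pi>\<^sub>M i\<in>insert i I. lborel))"
    using insert.hyps by (simp add: ennreal_mult mult_ac)
  finally show ?case .
qed

section \<open>Finitely supported sequences and orthonormal bases\<close>

lemma lookup_scaleR [simp]: "Poly_Mapping.lookup (r *\<^sub>R x) i = r *\<^sub>R Poly_Mapping.lookup x i"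
  by (simp add: scaleR_poly_mapping_def)

lemma norm_single [simp]: "norm (Poly_Mapping.single k v) = norm v"
  by (simp add: norm_poly_mapping_def dist_poly_mapping_def)

lemma poly_mapping_sum_single:
  "(\<Sum>k\<in>Poly_Mapping.keys x. Poly_Mapping.single k (Poly_Mapping.lookup x k)) = x"
  by (rule poly_mapping_eqI) (auto simp: lookup_sum lookup_single when_def in_keys_iff)

text \<open>Second countability makes sums and scalar multiples of measurable maps into
  \<open>rvec\<close> measurable, also on product spaces. A countable dense set consists of the
  finite sums of single entries taken from a countable dense set of coefficients.\<close>

instance poly_mapping :: (countable, "{real_normed_vector, second_countable_topology}") second_countable_topology
proof
  obtain D :: "'b set" where "countable D" and dense: "\<And>X. open X \<Longrightarrow> X \<noteq> {} \<Longrightarrow> \<exists>d\<in>D. d \<in> X"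
    using countable_dense_exists by blast
  define E where "E = (\<lambda>xs. \<Sum>(k, d)\<leftarrow>xs. Poly_Mapping.single (k :: 'a) d) ` lists (UNIV \<times> D)"
  have "countable E"
    unfolding E_def using \<open>countable D\<close> by (intro countable_image countable_lists countable_SIGMA) auto
  have approx: "\<exists>y\<in>E. dist x y < e" if "e > 0" for x :: "'a \<Rightarrow>\<^sub>0 'b" and e
  proof -
    \<comment> \<open>The added 1 keeps the divisor positive for x = 0 and makes the total error
      strictly smaller than \<open>e\<close>.\<close>
    let ?N = "real (card (Poly_Mapping.keys x)) + 1"
    have "\<exists>d\<in>D. dist (Poly_Mapping.lookup x k) d < e / ?N" for k
    proof -
      have "0 < e / ?N" using \<open>e > 0\<close> by simp
      then show ?thesis
        using dense[of "ball (Poly_Mapping.lookup x k) (e / ?N)"] centre_in_ball by (metis empty_iff mem_ball open_ball)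
    qed
    then obtain d where d: "\<And>k. d k \<in> D" "\<And>k. norm (Poly_Mapping.lookup x k - d k) < e / ?N"
      unfolding dist_norm by metis
    obtain ks where ks: "set ks = Poly_Mapping.keys x" "distinct ks"
      using finite_distinct_list[of "Poly_Mapping.keys x"] by auto
    let ?y = "\<Sum>k\<in>Poly_Mapping.keys x. Poly_Mapping.single k (d k)"
    have y: "?y = (\<Sum>(k, d)\<leftarrow>map (\<lambda>k. (k, d k)) ks. Poly_Mapping.single k d)"
      by (simp only: map_map o_def split_conv sum_list_distinct_conv_sum_set[OF ks(2)] ks(1))
    have "?y \<in> E"
      unfolding E_def by (rule image_eqI, rule y) (auto simp: in_lists_conv_set d(1))
    have "dist x ?y = norm (\<Sum>k\<in>Poly_Mapping.keys x. Poly_Mapping.single k (Poly_Mapping.lookup x k - d k))"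
      by (subst (1) poly_mapping_sum_single[symmetric])
        (simp add: dist_norm single_diff flip: sum_subtractf)
    also have "\<dots> \<le> (\<Sum>k\<in>Poly_Mapping.keys x. e / ?N)"
      using d(2) by (intro sum_norm_le) (simp add: less_imp_le)
    also have "\<dots> < e"
      using \<open>e > 0\<close> by (simp add: field_simps)
    finally show ?thesis using \<open>?y \<in> E\<close> by blast
  qed
  define B where "B = (\<lambda>(y, n). ball y (1 / real (Suc n))) ` (E \<times> (UNIV :: nat set))"
  have "countable B"
    unfolding B_def using \<open>countable E\<close> by (intro countable_image countable_SIGMA) auto
  moreover have "topological_basis B"
  proof (rule topological_basisI)
    fix O' and x :: "'a \<Rightarrow>\<^sub>0 'b" assume "open O'" "x \<in> O'"
    then obtain e where e: "e > 0" "ball x e \<subseteq> O'" by (auto simp: open_contains_ball)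
    then obtain n where n: "1 / real (Suc n) < e / 2" using nat_approx_posE[of "e / 2"] by auto
    obtain y where y: "y \<in> E" "dist x y < 1 / real (Suc n)" using approx[of "1 / real (Suc n)" x] by auto
    have "ball y (1 / real (Suc n)) \<subseteq> ball x e"
    proof
      fix z assume "z \<in> ball y (1 / real (Suc n))"
      then have "dist x z < 1 / real (Suc n) + 1 / real (Suc n)"
        using dist_triangle[of x z y] y(2) by (simp del: of_nat_Suc)
      then show "z \<in> ball x e" using n by (simp del: of_nat_Suc)
    qed
    then show "\<exists>B'\<in>B. x \<in> B' \<and> B' \<subseteq> O'"
      using y e(2) by (intro bexI[of _ "ball y (1 / real (Suc n))"]) (auto simp: B_def dist_commute simp del: of_nat_Suc)
  qed (auto simp: B_def)
  ultimately show "\<exists>B :: ('a \<Rightarrow>\<^sub>0 'b) set set. countable B \<and> open = generate_topology B"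
    using topological_basis_imp_subbasis by blast
qed

section \<open>The inner product and orthonormal families\<close>

lemma dot_eq_sum:
  assumes "finite S" "Poly_Mapping.keys x \<subseteq> S"
  shows "dot x y = (\<Sum>i\<in>S. Poly_Mapping.lookup x i * Poly_Mapping.lookup y i)"
  unfolding dot_def using assms by (intro sum.mono_neutral_left) (auto simp: in_keys_iff)

lemma dot_commute: "dot x y = dot y x"
  using dot_eq_sum[of "Poly_Mapping.keys x \<union> Poly_Mapping.keys y" x y]
    dot_eq_sum[of "Poly_Mapping.keys x \<union> Poly_Mapping.keys y" y x]
  by (simp add: mult.commute)

lemma linear_dot: "linear (\<lambda>y. dot x y)"
  by (rule linearI) (simp_all add: dot_def lookup_add distrib_left sum.distrib sum_distrib_left mult_ac)

lemmas dot_sum_right = linear_sum[OF linear_dot, unfolded o_def]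
  and dot_scaleR_right = linear_cmul[OF linear_dot]
  and dot_diff_right = linear_diff[OF linear_dot]

lemma dot_self_eq_0: "dot x x = 0 \<longleftrightarrow> x = 0"
proof
  assume "dot x x = 0"
  then have "\<forall>i\<in>Poly_Mapping.keys x. Poly_Mapping.lookup x i * Poly_Mapping.lookup x i = 0"
    unfolding dot_def by (subst (asm) sum_nonneg_eq_0_iff) auto
  then show "x = 0" by (intro poly_mapping_eqI) (auto simp: in_keys_iff)
qed (simp add: dot_def)

lemma dot_self_nonneg: "dot x x \<ge> 0"
  by (simp add: dot_def sum_nonneg)

text \<open>The norm of \<open>rvec\<close> is the l1 norm, which dominates every single coordinate.
  This estimate takes the place of Cauchy-Schwarz when coordinates of norm-bounded sets are
  bounded.\<close>

lemma abs_dot_le: "\<bar>dot x y\<bar> \<le> norm x * norm y"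
proof -
  have *: "norm z = (\<Sum>i\<in>Poly_Mapping.keys z. \<bar>Poly_Mapping.lookup z i\<bar>)" for z :: rvec
    by (simp add: norm_poly_mapping_def dist_poly_mapping_def)
  have "\<bar>Poly_Mapping.lookup y i\<bar> \<le> norm y" for i
  proof (cases "i \<in> Poly_Mapping.keys y")
    case True
    then show ?thesis unfolding * by (intro member_le_sum) auto
  qed (simp add: in_keys_iff)
  then have "\<bar>dot x y\<bar> \<le> (\<Sum>i\<in>Poly_Mapping.keys x. \<bar>Poly_Mapping.lookup x i\<bar> * norm y)"
    unfolding dot_def by (intro order_trans[OF sum_abs] sum_mono) (auto simp: abs_mult mult_left_mono)
  also have "\<dots> = norm x * norm y" by (simp add: * sum_distrib_right)
  finally show ?thesis .
qed

lemma subspace_Rn: "subspace (Rn n)"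
proof (rule subspaceI)
  show "x + y \<in> Rn n" if "x \<in> Rn n" "y \<in> Rn n" for x y
    using that keys_add[of x y] by (auto simp: Rn_def)
  show "c *\<^sub>R x \<in> Rn n" if "x \<in> Rn n" for c x
    using that by (auto simp: Rn_def in_keys_iff subset_iff)
qed (simp add: Rn_def)

definition orthonormal :: "rvec set \<Rightarrow> bool"
  where "orthonormal B \<longleftrightarrow> (\<forall>b\<in>B. \<forall>c\<in>B. dot b c = (if b = c then 1 else 0))"

lemma dot_sum_orthonormal:
  assumes "orthonormal B" "finite A" "A \<subseteq> B" "b \<in> A"
  shows "dot b (\<Sum>c\<in>A. f c *\<^sub>R c) = f b"
proof -
  have "dot b (\<Sum>c\<in>A. f c *\<^sub>R c) = (\<Sum>c\<in>A. f c * (if b = c then 1 else 0))"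
    using assms by (auto simp: dot_sum_right dot_scaleR_right orthonormal_def subset_iff intro!: sum.cong)
  also have "\<dots> = f b" using assms by (simp add: if_distrib cong: if_cong)
  finally show ?thesis .
qed

lemma orthonormal_independent:
  assumes "orthonormal B" shows "independent B"
proof
  assume "dependent B"
  then obtain A u where A: "finite A" "A \<subseteq> B" "(\<Sum>v\<in>A. u v *\<^sub>R v) = 0" "\<exists>v\<in>A. u v \<noteq> 0"
    unfolding dependent_explicit by blast
  then show False
    using dot_sum_orthonormal[OF assms A(1,2), of _ u] by (auto simp: linear_0[OF linear_dot])
qed

text \<open>The type \<open>rvec\<close> is infinite-dimensional, so finiteness has to come from the
  n unit vectors that span \<open>Rn n\<close>.\<close>

lemma independent_Rn_bound:
  assumes "independent B" "B \<subseteq> Rn n"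
  shows "finite B \<and> card B \<le> n"
proof -
  let ?E = "(\<lambda>i. Poly_Mapping.single i (1::real)) ` {..<n}"
  have "Rn n \<subseteq> span ?E"
  proof
    fix x assume "x \<in> Rn n"
    have "(\<Sum>k\<in>Poly_Mapping.keys x. Poly_Mapping.lookup x k *\<^sub>R Poly_Mapping.single k (1::real)) \<in> span ?E"
      using \<open>x \<in> Rn n\<close> by (intro span_sum span_scale span_base) (auto simp: Rn_def)
    moreover have "r *\<^sub>R Poly_Mapping.single k (1::real) = Poly_Mapping.single k r" for r and k :: nat
      by (rule poly_mapping_eqI) (auto simp: lookup_single when_def)
    ultimately show "x \<in> span ?E" by (simp add: poly_mapping_sum_single)
  qed
  then have "finite B \<and> card B \<le> card ?E"
    using assms by (intro independent_span_bound) auto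
  then show ?thesis using card_image_le[of "{..<n}" "\<lambda>i. Poly_Mapping.single i (1::real)"] by auto
qed

text \<open>Take an orthonormal subset of \<open>H\<close> with the most elements. If some vector
  differed from its orthogonal projection, the normalised residue could be added. Without existence,
  the choice of a basis in \<open>lborel_subspace\<close> would say nothing.\<close>

lemma orthonormal_basis_exists:
  assumes H: "subspace H" "H \<subseteq> Rn n"
  shows "\<exists>B. orthonormal_basis H B"
proof -
  let ?P = "\<lambda>k. \<exists>B. orthonormal B \<and> B \<subseteq> H \<and> card B = k"
  have bound: "finite B \<and> card B \<le> n" if "orthonormal B" "B \<subseteq> H" for B
    using independent_Rn_bound[OF orthonormal_independent] that H by blast
  have "?P 0" by (intro exI[of _ "{}"]) (simp add: orthonormal_def)
  moreover have "\<forall>k. ?P k \<longrightarrow> k \<le> n" using bound by blast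
  ultimately have "\<exists>k. ?P k \<and> (\<forall>j. ?P j \<longrightarrow> j \<le> k)"
    by (rule Nat.ex_has_greatest_nat)
  then obtain B where B: "orthonormal B" "B \<subseteq> H"
    and max: "\<And>B'. orthonormal B' \<Longrightarrow> B' \<subseteq> H \<Longrightarrow> card B' \<le> card B"
    by blast
  have fin: "finite B" using bound B by blast
  have "span B = H"
  proof
    show "span B \<subseteq> H" using B(2) H(1) by (rule span_minimal)
    show "H \<subseteq> span B"
    proof
      fix v assume "v \<in> H"
      \<comment> \<open>The orthogonal projection of \<open>v\<close> to the span of
        \<open>B\<close>.\<close>
      define p where "p = (\<Sum>b\<in>B. dot b v *\<^sub>R b)"
      have "p \<in> span B" unfolding p_def by (intro span_sum span_scale span_base)
      define w where "w = v - p"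
      have orth: "dot b w = 0" if "b \<in> B" for b
        using dot_sum_orthonormal[OF B(1) fin subset_refl that, of "\<lambda>b. dot b v"]
        by (simp add: w_def p_def dot_diff_right)
      have "w \<in> H" unfolding w_def
        using \<open>v \<in> H\<close> \<open>p \<in> span B\<close> \<open>span B \<subseteq> H\<close> H(1) by (intro subspace_diff) auto
      have "w = 0"
      proof (rule ccontr)
        assume "w \<noteq> 0"
        then have pos: "dot w w > 0" using dot_self_eq_0[of w] dot_self_nonneg[of w] by auto
        define u where "u = (1 / sqrt (dot w w)) *\<^sub>R w"
        have "dot u u = 1"
          using pos by (simp add: u_def dot_scaleR_right dot_commute[of "_ *\<^sub>R _" w])
        moreover have "dot b u = 0" "dot u b = 0" if "b \<in> B" for b
          using orth[OF that] by (simp_all add: u_def dot_scaleR_right dot_commute[of "_ *\<^sub>R _" b])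
        ultimately have "orthonormal (insert u B)" "u \<notin> B"
          using B(1) by (auto simp: orthonormal_def)
        moreover have "u \<in> H" unfolding u_def using H(1) \<open>w \<in> H\<close> by (rule subspace_scale)
        ultimately show False using max[of "insert u B"] B(2) fin by auto
      qed
      then show "v \<in> span B" using \<open>p \<in> span B\<close> by (simp add: w_def)
    qed
  qed
  then show ?thesis
    using B(1) unfolding orthonormal_def orthonormal_basis_def by (intro exI[of _ B] conjI)
qed

lemma orthonormal_basis_props:
  assumes B: "orthonormal_basis H B" and H: "H \<subseteq> Rn n"
  shows "orthonormal B" "finite B" "card B = dim H" "span B = H"
proof -
  show on: "orthonormal B" and sp: "span B = H"
    using B by (simp_all add: orthonormal_basis_def orthonormal_def)
  have "B \<subseteq> H" using sp span_superset by blast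
  with H show "finite B"
    using independent_Rn_bound[OF orthonormal_independent[OF on]] by blast
  show "card B = dim H"
    using dim_eq_card_independent[OF orthonormal_independent[OF on]] dim_span[of B] sp by simp
qed

section \<open>Lebesgue measure on a subspace\<close>

locale Rn_subspace =
  fixes n :: nat and H :: "rvec set"
  assumes subspace_H: "subspace H" and H_subset: "H \<subseteq> Rn n"
begin
text \<open>This must be the very term chosen inside \<open>lborel_subspace\<close>: the measure is
  then the image of \<open>coords\<close> under \<open>comb\<close> by mere unfolding, without
  appeal to independence of the basis.\<close>

definition basis :: "rvec set"
  where "basis = (SOME B. orthonormal_basis H B)"

definition coords :: "(rvec \<Rightarrow> real) measure"
  where "coords = (\<Pi>\<^sub>M b\<in>basis. lborel)"

definition comb :: "(rvec \<Rightarrow> real) \<Rightarrow> rvec"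
  where "comb f = (\<Sum>b\<in>basis. f b *\<^sub>R b)"

lemma orthonormal_basis: "orthonormal_basis H basis"
  unfolding basis_def using orthonormal_basis_exists[OF subspace_H H_subset] by (rule someI_ex)

lemmas basis_props = orthonormal_basis_props[OF orthonormal_basis H_subset]

lemma finite_basis [simp]: "finite basis"
  by (rule basis_props)

lemma lborel_subspace_eq: "lborel_subspace H = distr coords (restrict_space borel H) comb"
  by (simp add: lborel_subspace_def basis_def coords_def comb_def[abs_def] Let_def)

lemma space_lborel_subspace [simp]: "space (lborel_subspace H) = H"
  by (simp add: lborel_subspace_eq space_restrict_space)

lemma sets_lborel_subspace [measurable_cong]: "sets (lborel_subspace H) = sets (restrict_space borel H)"
  by (simp add: lborel_subspace_eq)

lemma space_coords: "space coords = extensional basis"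
  by (simp add: coords_def space_PiM PiE_def)

lemma comb_in: "comb f \<in> H"
proof -
  have "comb f \<in> span basis" unfolding comb_def by (intro span_sum span_scale span_base)
  then show ?thesis by (simp only: basis_props(4))
qed

lemma dot_comb: "b \<in> basis \<Longrightarrow> dot b (comb f) = f b"
  unfolding comb_def by (rule dot_sum_orthonormal[OF basis_props(1) finite_basis subset_refl])

lemma comb_surj:
  assumes "v \<in> H" obtains f where "comb f = v"
proof -
  have "v \<in> range (\<lambda>f. \<Sum>b\<in>basis. f b *\<^sub>R b)"
    using assms span_finite[OF finite_basis] basis_props(4) by blast
  then show thesis using that unfolding comb_def by blast
qed

lemma comb_restrict [simp]: "comb (restrict f basis) = comb f"
  by (simp add: comb_def)

lemma comb_affine: "comb (\<lambda>b. f b + c * g b) = comb f + c *\<^sub>R comb g"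
  by (simp add: comb_def scaleR_add_left sum.distrib scaleR_sum_right)

lemma borel_measurable_comb [measurable]: "comb \<in> borel_measurable coords"
  unfolding comb_def[abs_def] coords_def by measurable

lemma measurable_comb: "comb \<in> measurable coords (restrict_space borel H)"
  by (rule measurable_restrict_space2) (auto simp: comb_in)

lemma nn_integral_lborel_subspace:
  "g \<in> borel_measurable (lborel_subspace H) \<Longrightarrow>
    (\<integral>\<^sup>+x. g x \<partial>lborel_subspace H) = (\<integral>\<^sup>+f. g (comb f) \<partial>coords)"
  unfolding lborel_subspace_eq by (rule nn_integral_distr[OF measurable_comb]) simp

lemma measurable_comb_lborel_subspace:
  "g \<in> borel_measurable (lborel_subspace H) \<Longrightarrow> (\<lambda>f. g (comb f)) \<in> borel_measurable coords"
  by (rule measurable_compose[OF measurable_comb]) (simp cong: measurable_cong_sets add: sets_lborel_subspace)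

lemma measurable_from_borel: "f \<in> borel_measurable borel \<Longrightarrow> f \<in> borel_measurable (lborel_subspace H)"
  by (simp add: measurable_restrict_space1 cong: measurable_cong_sets add: sets_lborel_subspace)

lemma measurable_affine:
  assumes "v \<in> H"
  shows "(\<lambda>x. v + c *\<^sub>R x) \<in> measurable (lborel_subspace H) (lborel_subspace H)"
proof -
  have "(\<lambda>x. v + c *\<^sub>R x) \<in> measurable (restrict_space borel H) (restrict_space borel H)"
    using assms subspace_H
    by (intro measurable_restrict_space2 measurable_restrict_space1)
      (auto simp: space_restrict_space intro: subspace_add subspace_scale)
  then show ?thesis by (simp cong: measurable_cong_sets add: sets_lborel_subspace)
qed

lemma nn_integral_affine:
  assumes g: "g \<in> borel_measurable (lborel_subspace H)" and v: "v \<in> H" and c: "c \<noteq> 0"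
  shows "(\<integral>\<^sup>+x. g x \<partial>lborel_subspace H) =
    ennreal (\<bar>c\<bar> ^ dim H) * (\<integral>\<^sup>+x. g (v + c *\<^sub>R x) \<partial>lborel_subspace H)"
proof -
  obtain w where w: "comb w = v" using comb_surj[OF v] .
  have m: "(\<lambda>x. g (v + c *\<^sub>R x)) \<in> borel_measurable (lborel_subspace H)"
    by (rule measurable_compose[OF measurable_affine[OF v] g])
  have "(\<integral>\<^sup>+x. g x \<partial>lborel_subspace H) = (\<integral>\<^sup>+f. g (comb f) \<partial>coords)"
    by (rule nn_integral_lborel_subspace[OF g])
  also have "\<dots> = ennreal (\<bar>c\<bar> ^ card basis) * (\<integral>\<^sup>+f. g (comb (\<lambda>b\<in>basis. w b + c * f b)) \<partial>coords)"
    using measurable_comb_lborel_subspace[OF g] unfolding coords_def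
    by (intro nn_integral_PiM_affine c) auto
  also have "\<dots> = ennreal (\<bar>c\<bar> ^ dim H) * (\<integral>\<^sup>+x. g (v + c *\<^sub>R x) \<partial>lborel_subspace H)"
    by (simp add: nn_integral_lborel_subspace[OF m] comb_affine w basis_props(3))
  finally show ?thesis .
qed

lemma prekopa_leindler:
  assumes meas: "f \<in> borel_measurable (lborel_subspace H)" "g \<in> borel_measurable (lborel_subspace H)"
      "h \<in> borel_measurable (lborel_subspace H)"
    and mid: "\<And>x y. x \<in> H \<Longrightarrow> y \<in> H \<Longrightarrow> f x * g y \<le> (h ((1 / 2) *\<^sub>R (x + y)))\<^sup>2"
  shows "(\<integral>\<^sup>+x. f x \<partial>lborel_subspace H) * (\<integral>\<^sup>+x. g x \<partial>lborel_subspace H) \<le> (\<integral>\<^sup>+x. h x \<partial>lborel_subspace H)\<^sup>2"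
  unfolding nn_integral_lborel_subspace[OF meas(1)] nn_integral_lborel_subspace[OF meas(2)]
    nn_integral_lborel_subspace[OF meas(3)] coords_def
proof (rule prekopa_leindler_PiM)
  fix x y :: "rvec \<Rightarrow> real"
  have "comb (\<lambda>i\<in>basis. (x i + y i) / 2) = (1 / 2) *\<^sub>R (comb x + comb y)"
    by (simp add: comb_def scaleR_sum_right scaleR_add_left add_divide_distrib scaleR_add_right sum.distrib)
  then show "f (comb x) * g (comb y) \<le> (h (comb (\<lambda>i\<in>basis. (x i + y i) / 2)))\<^sup>2"
    using mid[OF comb_in comb_in, of x y] by simp
qed (use meas in \<open>auto intro: measurable_comb_lborel_subspace simp flip: coords_def\<close>)

section \<open>Sets of finite, of positive and of zero measure in a subspace\<close>

lemma emeasure_bounded_finite: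
  assumes A: "A \<in> sets (lborel_subspace H)" and "bounded A"
  shows "emeasure (lborel_subspace H) A < \<infinity>"
proof -
  obtain R where R: "\<And>x. x \<in> A \<Longrightarrow> norm x \<le> R" using \<open>bounded A\<close> by (auto simp: bounded_iff)
  have A': "A \<in> sets (restrict_space borel H)" using A by (simp add: sets_lborel_subspace)
  have "emeasure (lborel_subspace H) A = emeasure coords (comb -` A \<inter> space coords)"
    unfolding lborel_subspace_eq by (rule emeasure_distr[OF measurable_comb A'])
  \<comment> \<open>The coordinates of a point are its inner products with the basis vectors, so a
    bound on the norm confines them to a box.\<close>
  also have "\<dots> \<le> emeasure coords (Pi\<^sub>E basis (\<lambda>b. {- (norm b * R)..norm b * R}))"
  proof (rule emeasure_mono)
    show "comb -` A \<inter> space coords \<subseteq> (\<Pi>\<^sub>E b\<in>basis. {- (norm b * R)..norm b * R})"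
    proof
      fix f assume f: "f \<in> comb -` A \<inter> space coords"
      have bd: "\<bar>f b\<bar> \<le> norm b * R" if "b \<in> basis" for b
      proof -
        have "\<bar>f b\<bar> \<le> norm b * norm (comb f)"
          using abs_dot_le[of b "comb f"] dot_comb[OF that] by simp
        also have "\<dots> \<le> norm b * R" using R f by (intro mult_left_mono) auto
        finally show ?thesis .
      qed
      show "f \<in> (\<Pi>\<^sub>E b\<in>basis. {- (norm b * R)..norm b * R})"
      proof (rule PiE_I)
        show "f b \<in> {- (norm b * R)..norm b * R}" if "b \<in> basis" for b
          using bd[OF that] by (simp add: abs_le_iff)
        show "f b = undefined" if "b \<notin> basis" for b
          using f that by (simp add: space_coords extensional_def)
      qed
    qed
  qed (auto simp: coords_def intro!: sets_PiM_I_finite)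
  also have "\<dots> = (\<Prod>b\<in>basis. emeasure lborel {- (norm b * R)..norm b * R})"
    unfolding coords_def by (rule lborel_product.emeasure_PiM) auto
  also have "\<dots> < \<infinity>"
    unfolding emeasure_lborel_Icc_eq by (subst prod_ennreal) (auto simp: mult.commute)
  finally show ?thesis .
qed

lemma Int_borel_in_sets: "A \<in> sets borel \<Longrightarrow> A \<inter> H \<in> sets (lborel_subspace H)"
  by (auto simp: sets_lborel_subspace sets_restrict_space)

lemma sigma_finite: "sigma_finite_measure (lborel_subspace H)"
proof (rule sigma_finite_measure.intro)
  show "\<exists>A. countable A \<and> A \<subseteq> sets (lborel_subspace H) \<and> \<Union> A = space (lborel_subspace H)
      \<and> (\<forall>a\<in>A. emeasure (lborel_subspace H) a \<noteq> \<infinity>)"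
  proof (intro exI conjI ballI)
    let ?A = "range (\<lambda>k :: nat. cball 0 (real k) \<inter> H)"
    show "\<Union> ?A = space (lborel_subspace H)"
      using real_arch_simple by (auto simp: dist_norm)
    fix a assume "a \<in> ?A"
    then show "emeasure (lborel_subspace H) a \<noteq> \<infinity>"
      using emeasure_bounded_finite[of a] Int_borel_in_sets bounded_subset[OF bounded_cball Int_lower1] by fastforce
  qed (auto intro: Int_borel_in_sets)
qed

lemma emeasure_H_nonzero: "emeasure (lborel_subspace H) H \<noteq> 0"
proof -
  have "1 = emeasure coords (Pi\<^sub>E basis (\<lambda>b. {0..1}))"
    unfolding coords_def by (subst lborel_product.emeasure_PiM) auto
  also have "\<dots> \<le> emeasure coords (comb -` H \<inter> space coords)"
  proof (rule emeasure_mono)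
    show "Pi\<^sub>E basis (\<lambda>b. {0..1}) \<subseteq> comb -` H \<inter> space coords"
      by (auto simp: space_coords PiE_def comb_in)
    have "comb -` H \<inter> space coords = space coords" by (auto simp: comb_in)
    then show "comb -` H \<inter> space coords \<in> sets coords" by simp
  qed
  also have "\<dots> = emeasure (lborel_subspace H) H"
    unfolding lborel_subspace_eq by (rule emeasure_distr[symmetric, OF measurable_comb])
      (use sets.top[of "restrict_space borel H"] in \<open>simp add: space_restrict_space\<close>)
  finally show ?thesis by auto
qed

text \<open>The integer dilates of \<open>A\<close> cover \<open>H\<close> and their measures are
  multiples of that of \<open>A\<close>; if \<open>A\<close> were null, \<open>H\<close> would be a
  countable union of null sets. This replaces any discussion of interior points relative to
  \<open>H\<close>.\<close>

lemma emeasure_absorbing_nonzero: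
  assumes A[measurable]: "A \<in> sets (lborel_subspace H)"
    and absorbing: "\<And>v. v \<in> H \<Longrightarrow> \<exists>k::nat. k > 0 \<and> (1 / real k) *\<^sub>R v \<in> A"
  shows "emeasure (lborel_subspace H) A \<noteq> 0"
proof
  assume zero: "emeasure (lborel_subspace H) A = 0"
  let ?S = "\<lambda>k. {x \<in> H. (1 / real (Suc k)) *\<^sub>R x \<in> A}"
  have meas: "?S k \<in> sets (lborel_subspace H)" for k
  proof -
    have "(\<lambda>x. 0 + (1 / real (Suc k)) *\<^sub>R x) -` A \<inter> space (lborel_subspace H) \<in> sets (lborel_subspace H)"
      by (rule measurable_sets[OF measurable_affine A]) (simp add: subspace_0 subspace_H)
    also have "(\<lambda>x. 0 + (1 / real (Suc k)) *\<^sub>R x) -` A \<inter> space (lborel_subspace H) = ?S k" by auto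
    finally show ?thesis .
  qed
  have "emeasure (lborel_subspace H) (?S k) = 0" for k
  proof -
    have "0 = (\<integral>\<^sup>+x. indicator A x \<partial>lborel_subspace H)" using zero by simp
    also have "\<dots> = ennreal (\<bar>1 / real (Suc k)\<bar> ^ dim H) * (\<integral>\<^sup>+x. indicator A (0 + (1 / real (Suc k)) *\<^sub>R x) \<partial>lborel_subspace H)"
      by (rule nn_integral_affine) (auto simp: subspace_0 subspace_H)
    also have "(\<integral>\<^sup>+x. indicator A (0 + (1 / real (Suc k)) *\<^sub>R x) \<partial>lborel_subspace H) = (\<integral>\<^sup>+x. indicator (?S k) x \<partial>lborel_subspace H)"
      by (intro nn_integral_cong) (auto simp: indicator_def)
    also have "\<dots> = emeasure (lborel_subspace H) (?S k)" using meas by simp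
    finally show ?thesis by auto
  qed
  then have "emeasure (lborel_subspace H) (\<Union>k. ?S k) = 0"
    using meas by (intro emeasure_UN_eq_0) auto
  moreover have "(\<Union>k. ?S k) = H"
  proof
    show "H \<subseteq> (\<Union>k. ?S k)"
    proof
      fix v assume "v \<in> H"
      then obtain k :: nat where "k > 0" "(1 / real k) *\<^sub>R v \<in> A" using absorbing by blast
      then have "v \<in> ?S (k - 1)" using \<open>v \<in> H\<close> by simp
      then show "v \<in> (\<Union>k. ?S k)" by (rule UN_I[OF UNIV_I])
    qed
  qed blast
  ultimately show False using emeasure_H_nonzero by simp
qed

lemma emeasure_proper_subspace:
  assumes A: "A \<in> sets (lborel_subspace H)" and "A \<subseteq> V" "subspace V" "\<not> H \<subseteq> V"
  shows "emeasure (lborel_subspace H) A = 0"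
proof -
  \<comment> \<open>The translates of a bounded piece of \<open>A\<close> by \<open>v / (k + 1)\<close> are disjoint, of equal measure
    and contained in one bounded set.\<close>
  obtain v where v: "v \<in> H" "v \<notin> V" using \<open>\<not> H \<subseteq> V\<close> by blast
  have A_cball: "A \<inter> cball 0 R \<in> sets (lborel_subspace H)" for R
  proof -
    have "A \<inter> cball 0 R = A \<inter> (cball 0 R \<inter> H)" using sets.sets_into_space[OF A] by auto
    then show ?thesis using sets.Int[OF A Int_borel_in_sets[of "cball 0 R"]] by simp
  qed
  have piece: "emeasure (lborel_subspace H) (A \<inter> cball 0 (real R)) = 0" for R :: nat
  proof -
    let ?A = "A \<inter> cball 0 (real R)"
    let ?S = "\<lambda>k. {x \<in> H. - (1 / real (Suc k)) *\<^sub>R v + 1 *\<^sub>R x \<in> ?A}"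
    have A'[measurable]: "?A \<in> sets (lborel_subspace H)" by (rule A_cball)
    have vk: "- (1 / real (Suc k)) *\<^sub>R v \<in> H" for k using v(1) subspace_H by (intro subspace_scale)
    have meas: "?S k \<in> sets (lborel_subspace H)" for k
    proof -
      have "(\<lambda>x. - (1 / real (Suc k)) *\<^sub>R v + 1 *\<^sub>R x) -` ?A \<inter> space (lborel_subspace H) \<in> sets (lborel_subspace H)"
        by (rule measurable_sets[OF measurable_affine[OF vk] A'])
      also have "(\<lambda>x. - (1 / real (Suc k)) *\<^sub>R v + 1 *\<^sub>R x) -` ?A \<inter> space (lborel_subspace H) = ?S k" by auto
      finally show ?thesis .
    qed
    have eq: "emeasure (lborel_subspace H) (?S k) = emeasure (lborel_subspace H) ?A" for k
    proof -
      have "emeasure (lborel_subspace H) ?A = (\<integral>\<^sup>+x. indicator ?A x \<partial>lborel_subspace H)" by simp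
      also have "\<dots> = ennreal (\<bar>1\<bar> ^ dim H) * (\<integral>\<^sup>+x. indicator ?A (- (1 / real (Suc k)) *\<^sub>R v + 1 *\<^sub>R x) \<partial>lborel_subspace H)"
        by (rule nn_integral_affine[OF _ vk]) auto
      also have "\<dots> = (\<integral>\<^sup>+x. indicator (?S k) x \<partial>lborel_subspace H)"
        by (simp, intro nn_integral_cong) (auto simp: indicator_def)
      also have "\<dots> = emeasure (lborel_subspace H) (?S k)" using meas by simp
      finally show ?thesis by simp
    qed
    have "disjoint_family ?S"
      unfolding disjoint_family_on_def
    proof (intro ballI impI)
      fix j k :: nat assume "j \<noteq> k"
      show "?S j \<inter> ?S k = {}"
      proof (rule ccontr)
        assume "?S j \<inter> ?S k \<noteq> {}"
        then obtain x where "- (1 / real (Suc j)) *\<^sub>R v + 1 *\<^sub>R x \<in> V" "- (1 / real (Suc k)) *\<^sub>R v + 1 *\<^sub>R x \<in> V"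
          using \<open>A \<subseteq> V\<close> by blast
        then have "(- (1 / real (Suc j)) *\<^sub>R v + 1 *\<^sub>R x) - (- (1 / real (Suc k)) *\<^sub>R v + 1 *\<^sub>R x) \<in> V"
          by (rule subspace_diff[OF \<open>subspace V\<close>])
        also have "(- (1 / real (Suc j)) *\<^sub>R v + 1 *\<^sub>R x) - (- (1 / real (Suc k)) *\<^sub>R v + 1 *\<^sub>R x)
            = (1 / real (Suc k) - 1 / real (Suc j)) *\<^sub>R v"
          by (simp add: scaleR_diff_left del: of_nat_Suc)
        finally have "(1 / (1 / real (Suc k) - 1 / real (Suc j))) *\<^sub>R (1 / real (Suc k) - 1 / real (Suc j)) *\<^sub>R v \<in> V"
          by (rule subspace_scale[OF \<open>subspace V\<close>])
        moreover have "1 / real (Suc k) - 1 / real (Suc j) \<noteq> 0"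
          using \<open>j \<noteq> k\<close> by (simp del: of_nat_Suc)
        ultimately show False using v(2) by (simp del: of_nat_Suc)
      qed
    qed
    have "(\<Union>k. ?S k) \<subseteq> cball 0 (real R + norm v)"
    proof
      fix x assume "x \<in> (\<Union>k. ?S k)"
      then obtain k where k: "norm (- (1 / real (Suc k)) *\<^sub>R v + 1 *\<^sub>R x) \<le> real R" by auto
      have "norm x \<le> norm (- (1 / real (Suc k)) *\<^sub>R v + 1 *\<^sub>R x) + norm ((1 / real (Suc k)) *\<^sub>R v)"
        by (rule norm_triangle_le[of "- (1 / real (Suc k)) *\<^sub>R v + 1 *\<^sub>R x" "(1 / real (Suc k)) *\<^sub>R v", simplified]) simp
      also have "norm ((1 / real (Suc k)) *\<^sub>R v) \<le> norm v" 
        by (simp add: divide_le_eq del: of_nat_Suc) (simp add: algebra_simps)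
      finally show "x \<in> cball 0 (real R + norm v)" using k by (simp del: of_nat_Suc)
    qed
    then have "bounded (\<Union>k. ?S k)" using bounded_cball bounded_subset by blast
    then have "emeasure (lborel_subspace H) (\<Union>k. ?S k) < \<infinity>"
      using meas by (intro emeasure_bounded_finite sets.countable_UN) auto
    also have "emeasure (lborel_subspace H) (\<Union>k. ?S k) = suminf (\<lambda>k. emeasure (lborel_subspace H) (?S k))"
      using meas \<open>disjoint_family ?S\<close> by (intro suminf_emeasure[symmetric]) auto
    \<comment> \<open>All terms of the series are equal and the sum is finite, so the common value
      is 0: a nonzero constant integrates to \<open>top\<close> over infinitely many points.\<close>
    also have "\<dots> = (\<integral>\<^sup>+k. emeasure (lborel_subspace H) ?A \<partial>count_space (UNIV :: nat set))"
      by (simp only: eq nn_integral_count_space_nat)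
    finally show ?thesis by (auto simp: ennreal_mult_top split: if_splits)
  qed
  have "emeasure (lborel_subspace H) (\<Union>R::nat. A \<inter> cball 0 (real R)) = 0"
  proof (rule emeasure_UN_eq_0[OF piece])
    show "range (\<lambda>R. A \<inter> cball 0 (real R)) \<subseteq> sets (lborel_subspace H)"
      using A_cball by blast
  qed
  also have "(\<Union>R::nat. A \<inter> cball 0 (real R)) = A" using real_arch_simple by (auto simp: dist_norm)
  finally show ?thesis .
qed

end

section \<open>The beta integral and the binomial coefficient\<close>

text \<open>The integral is n B(m+1, n) = n m! (n-1)! / (n+m)!, evaluated through the Gamma
  function.\<close>

lemma nn_integral_beta_binomial:
  assumes "n \<ge> 1"
  shows "(\<integral>\<^sup>+t. ennreal (real n * (1 - t) ^ (n - 1)) * indicator {0<..<1} t * ennreal (t ^ m) \<partial>lborel)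
    = ennreal (1 / real ((n + m) choose m))"
proof -
  define w where "w = (\<lambda>t::real. if t \<in> {0<..<1} then t ^ m * (1 - t) ^ (n - 1) else 0)"
  \<comment> \<open>The Beta integral is stated with \<open>powr\<close>, which agrees with natural
    powers at positive bases; hence the cut to the open interval. Truncated subtraction in n - 1 is
    harmless since n >= 1.\<close>
  have w: "w t = (if t \<in> {0<..<1} then t powr (real m + 1 - 1) * (1 - t) powr (real n - 1) else 0)" for t
  proof -
    have "real n - 1 = real (n - 1)" using assms by simp
    then show ?thesis
      by (simp only: w_def add_diff_cancel_right') (auto simp: powr_realpow simp del: of_nat_diff)
  qed
  have "((\<lambda>t. t powr (real m + 1 - 1) * (1 - t) powr (real n - 1)) has_integral Beta (real m + 1) (real n)) {0<..<1}"
    using has_integral_Beta_real[of "real m + 1" "real n"] assms by (simp add: has_integral_Icc_iff_Ioo)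
  then have "(w has_integral Beta (real m + 1) (real n)) UNIV"
    unfolding w[abs_def] by (simp only: has_integral_restrict_UNIV)
  moreover have wm[measurable]: "w \<in> borel_measurable borel" unfolding w_def by measurable
  ultimately have int: "(\<integral>\<^sup>+t. ennreal (w t) \<partial>lborel) = ennreal (Beta (real m + 1) (real n))"
    by (intro nn_integral_has_integral_lborel) (auto simp: w_def)
  obtain l where l: "n = Suc l" using assms by (cases n) auto
  have "Beta (real m + 1) (real n) = fact m * fact l / fact (n + m)"
    using Gamma_fact[of m, where ?'a = real] Gamma_fact[of l, where ?'a = real] Gamma_fact[of "n + m", where ?'a = real]
      Gamma_fact[of "l + m + 1", where ?'a = real]
    by (simp add: Beta_def l add_ac)
  then have beta: "real n * Beta (real m + 1) (real n) = 1 / real ((n + m) choose m)"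
    by (simp add: binomial_fact l field_simps)
  have "(\<integral>\<^sup>+t. ennreal (real n * (1 - t) ^ (n - 1)) * indicator {0<..<1} t * ennreal (t ^ m) \<partial>lborel)
      = (\<integral>\<^sup>+t. ennreal (real n) * ennreal (w t) \<partial>lborel)"
    by (intro nn_integral_cong) (auto simp: w_def indicator_def mult_ac simp flip: ennreal_mult)
  also have "\<dots> = ennreal (real n) * ennreal (Beta (real m + 1) (real n))"
    by (subst nn_integral_cmult) (simp_all only: int, measurable)
  also have "\<dots> = ennreal (real n * Beta (real m + 1) (real n))"
    by (simp add: ennreal_mult')
  finally show ?thesis by (simp only: beta)
qed

text \<open>The constant 2e arises from two estimates: (n+m choose m) m! <= (n+m)^m <= (2n)^m, and
  m^m <= e^m m!, where the latter keeps a single term of the exponential series.\<close>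

lemma binomial_root_le:
  assumes "1 \<le> m" "m \<le> n"
  shows "real ((n + m) choose m) powr (1 / real m) \<le> 2 * exp 1 * (real n / real m)"
proof -
  have "(\<Sum>k\<in>{m}. inverse (fact k) * real m ^ k) \<le> suminf (\<lambda>k. inverse (fact k) * real m ^ k)"
    by (rule sum_le_suminf) (use summable_exp[of "real m"] in auto)
  then have e: "real m ^ m \<le> exp (real m) * fact m"
    by (simp add: exp_def field_simps scaleR_conv_of_real)
  have "real ((n + m) choose m) * fact m \<le> real (n + m) ^ m"
    using binomial_fact_pow[of "n + m" m] by (metis of_nat_fact of_nat_le_iff of_nat_mult of_nat_power)
  also have "\<dots> \<le> (2 * real n) ^ m"
    using assms by (intro power_mono) auto
  finally have "real ((n + m) choose m) * fact m * real m ^ m \<le> (2 * real n) ^ m * (exp (real m) * fact m)"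
    by (rule mult_mono) (use e in auto)
  then have "real ((n + m) choose m) * real m ^ m \<le> (2 * real n) ^ m * exp (real m)"
    by (simp add: mult.assoc[symmetric] mult.commute[of _ "fact m"] mult.left_commute[of _ "fact m"])
  also have "\<dots> = (2 * exp 1 * real n) ^ m"
    by (simp add: power_mult_distrib flip: exp_of_nat_mult)
  finally have "real ((n + m) choose m) \<le> (2 * exp 1 * (real n / real m)) ^ m"
    using assms by (simp add: field_simps power_divide)
  then have "real ((n + m) choose m) powr (1 / real m) \<le> ((2 * exp 1 * (real n / real m)) ^ m) powr (1 / real m)"
    by (intro powr_mono2) auto
  also have "\<dots> = 2 * exp 1 * (real n / real m)"
    using assms by (simp add: powr_powr flip: powr_realpow)
  finally show ?thesis .
qed

lemma ennreal_power2_le_imp_le: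
  assumes "a\<^sup>2 \<le> b\<^sup>2" shows "a \<le> (b :: ennreal)"
proof (cases "b = top")
  case False
  then obtain y where y: "b = ennreal y" "y \<ge> 0" by (cases b) auto
  have "a \<noteq> top"
    using assms y by (auto simp: ennreal_power top_unique power2_eq_square ennreal_mult_eq_top_iff)
  then obtain x where x: "a = ennreal x" "x \<ge> 0" by (cases a) auto
  then have "x\<^sup>2 \<le> y\<^sup>2" using assms y by (simp add: ennreal_power)
  then have "x \<le> y" using y(2) by (rule power2_le_imp_le)
  then show ?thesis using x y by simp
qed simp

text \<open>R^n is treated as a subspace of itself. Under the prefix \<open>full\<close>, the same
  lemmas serve for the volume of \<open>K\<close> and for the measure mu on the whole space.\<close>

sublocale Rn_subspace \<subseteq> full: Rn_subspace n "Rn n"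
  by unfold_locales (auto simp: subspace_Rn)

section \<open>Sections of a convex body under an even quasi-concave density\<close>

locale symmetric_section = Rn_subspace +
  fixes \<phi> :: "rvec \<Rightarrow> real" and K :: "rvec set"
  assumes phi_measurable: "\<phi> \<in> borel_measurable (restrict_space borel (Rn n))"
    and phi_bounded: "bounded (\<phi> ` Rn n)"
    and phi_even: "x \<in> Rn n \<Longrightarrow> \<phi> (- x) = \<phi> x"
    and phi_quasi_concave: "quasi_concave_on (Rn n) \<phi>"
    and phi_nonzero: "emeasure (measure_with_density \<phi> (Rn n)) (Rn n) \<noteq> 0"
    and body: "convex_body n K"
begin

section \<open>The geometry of K - K and the radial behaviour of the density\<close>

abbreviation D :: "rvec set" where "D \<equiv> difference_body K"

lemma K_subset: "K \<subseteq> Rn n" and K_compact: "compact K" and K_convex: "convex K"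
  using body by (auto simp: convex_body_def)

lemma K_borel [measurable]: "K \<in> sets borel"
  using K_compact by (simp add: compact_imp_closed)

lemma D_compact: "compact D"
  using compact_differences[OF K_compact K_compact] by (simp add: difference_body_def)

lemma D_borel [measurable]: "D \<in> sets borel"
  using D_compact by (simp add: compact_imp_closed)

lemma D_convex: "convex D"
proof -
  have "D = (\<Union>x\<in>K. \<Union>y\<in>K. {x - y})" by (auto simp: difference_body_def)
  then show ?thesis using convex_differences[OF K_convex K_convex] by simp
qed

text \<open>\<open>Rn n\<close> has empty interior in \<open>rvec\<close>, so the interior of
  \<open>K\<close> is relative to \<open>Rn n\<close> and only perturbations inside
  \<open>Rn n\<close> are available.\<close>

lemma K_interior:
  obtains k \<epsilon> where "k \<in> K" "\<epsilon> > 0" "\<And>v. v \<in> Rn n \<Longrightarrow> norm v < \<epsilon> \<Longrightarrow> k + v \<in> K"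
proof -
  obtain k where "k \<in> top_of_set (Rn n) interior_of K" using body by (auto simp: convex_body_def)
  then obtain T where T: "openin (top_of_set (Rn n)) T" "k \<in> T" "T \<subseteq> K"
    by (auto simp: interior_of_def)
  then obtain U where U: "open U" "T = Rn n \<inter> U" by (auto simp: openin_open)
  with T obtain \<epsilon> where e: "\<epsilon> > 0" "ball k \<epsilon> \<subseteq> U" by (auto simp: open_contains_ball)
  show thesis
  proof (rule that[of k \<epsilon>])
    show "k + v \<in> K" if "v \<in> Rn n" "norm v < \<epsilon>" for v
    proof -
      have "k + v \<in> ball k \<epsilon>" using that by (simp add: dist_norm)
      moreover have "k + v \<in> Rn n" using that T U subspace_Rn by (auto intro: subspace_add)
      ultimately show ?thesis using e T U by auto
    qed
  qed (use e T in auto)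
qed

lemma D_zero: "0 \<in> D"
proof -
  obtain k \<epsilon> where "k \<in> K" using K_interior .
  then show ?thesis by (force simp: difference_body_def)
qed

lemma D_star: "x \<in> D \<Longrightarrow> 0 \<le> s \<Longrightarrow> s \<le> 1 \<Longrightarrow> s *\<^sub>R x \<in> D"
  using convexD_alt[OF D_convex D_zero, of x s] by simp

lemma phi_nonneg: "x \<in> Rn n \<Longrightarrow> 0 \<le> \<phi> x"
  using phi_quasi_concave by (simp add: quasi_concave_on_def)

lemma phi_min: "x \<in> Rn n \<Longrightarrow> y \<in> Rn n \<Longrightarrow> 0 \<le> t \<Longrightarrow> t \<le> 1 \<Longrightarrow> min (\<phi> x) (\<phi> y) \<le> \<phi> ((1 - t) *\<^sub>R x + t *\<^sub>R y)"
  using phi_quasi_concave by (simp add: quasi_concave_on_def)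

text \<open>The midpoint of x and -x is 0, so evenness gives phi x <= phi 0; then quasi-concavity on
  the segment from 0 to x applies. Thus phi does not increase along rays.\<close>

lemma phi_star:
  assumes x: "x \<in> Rn n" and s: "0 \<le> s" "s \<le> 1"
  shows "\<phi> x \<le> \<phi> (s *\<^sub>R x)"
proof -
  have "- x \<in> Rn n" using x subspace_Rn by (rule subspace_neg[rotated])
  then have "min (\<phi> x) (\<phi> (- x)) \<le> \<phi> ((1 - 1 / 2) *\<^sub>R x + (1 / 2) *\<^sub>R (- x))"
    using x by (intro phi_min) auto
  then have "\<phi> x \<le> \<phi> 0" using phi_even[OF x] by (simp add: scaleR_diff_left)
  moreover have "min (\<phi> 0) (\<phi> x) \<le> \<phi> ((1 - s) *\<^sub>R 0 + s *\<^sub>R x)"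
    using x s by (intro phi_min) (auto intro: subspace_0 subspace_Rn)
  ultimately show ?thesis by simp
qed

lemma phi_measurable_H [measurable]: "\<phi> \<in> borel_measurable (lborel_subspace H)"
proof -
  have "\<phi> \<in> borel_measurable (restrict_space borel H)"
    using phi_measurable H_subset measurable_restrict_mono by blast
  then show ?thesis by (simp cong: measurable_cong_sets add: sets_lborel_subspace)
qed

lemma indicator_measurable_H [measurable]:
  "A \<in> sets borel \<Longrightarrow> (indicator A :: rvec \<Rightarrow> ennreal) \<in> borel_measurable (lborel_subspace H)"
  by (rule measurable_from_borel) simp

section \<open>The lower bound: sections of translates against the central section of K - K\<close>

lemma section_measure_finite: "section_measure \<phi> H D < \<infinity>"
proof -
  obtain M where M: "\<And>x. x \<in> Rn n \<Longrightarrow> \<bar>\<phi> x\<bar> \<le> M" using phi_bounded by (auto simp: bounded_iff)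
  have "section_measure \<phi> H D \<le> (\<integral>\<^sup>+x. ennreal M * indicator (D \<inter> H) x \<partial>lborel_subspace H)"
    unfolding section_measure_def
    using M H_subset by (intro nn_integral_mono) (force simp: indicator_def intro: ennreal_leI)
  also have "\<dots> = ennreal M * emeasure (lborel_subspace H) (D \<inter> H)"
    using Int_borel_in_sets[OF D_borel] by (rule nn_integral_cmult_indicator)
  also have "\<dots> < \<infinity>"
    using emeasure_bounded_finite[OF Int_borel_in_sets[OF D_borel]] compact_imp_bounded[OF D_compact]
    by (auto simp: ennreal_mult_less_top bounded_Int)
  finally show ?thesis .
qed

text \<open>On each level Prekopa-Leindler is applied to the indicator of a piece of
  \<open>?A\<close> and to its reflection, which has the same integral; the left side is then a
  square and the root can be taken. For u = a - y and -v = b - y the shift cancels in u + v = a - b,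
  so \<open>y\<close> may lie anywhere in R^n, not only in \<open>H\<close>.\<close>

lemma section_measure_le_difference:
  assumes y: "y \<in> Rn n"
  shows "section_measure \<phi> H ((\<lambda>x. x - y) ` K) \<le> section_measure \<phi> H D"
proof -
  let ?A = "(\<lambda>x. x - y) ` K"
  have A[measurable]: "?A \<in> sets borel"
    using compact_translation_subtract[OF K_compact, of y] by (simp add: compact_imp_closed)
  have zero: "0 \<in> H" using subspace_H by (rule subspace_0)
  interpret pair_sigma_finite lborel "lborel_subspace H"
    by (intro pair_sigma_finite.intro sigma_finite lborel.sigma_finite_measure_axioms)
  \<comment> \<open>The indicator of \<open>S\<close> cut by the superlevel set of height
    \<open>t\<close>; integrating over t > 0 recovers the density.\<close>
  define F where "F = (\<lambda>S t x. indicator S x * indicator {y. t < \<phi> y} x :: ennreal)"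
  have F[measurable]: "F S t \<in> borel_measurable (lborel_subspace H)" if [measurable]: "S \<in> sets borel" for S t
    unfolding F_def by measurable
  have layers: "section_measure \<phi> H S =
      (\<integral>\<^sup>+t. indicator {0<..} t * (\<integral>\<^sup>+x. F S t x \<partial>lborel_subspace H) \<partial>lborel)"
    if [measurable]: "S \<in> sets borel" for S
  proof -
    have S': "(\<lambda>p. indicator S (snd p) :: ennreal) \<in> borel_measurable (lborel \<Otimes>\<^sub>M lborel_subspace H)"
      by (rule measurable_compose[OF measurable_snd]) measurable
    have "(\<lambda>p. \<phi> (snd p)) \<in> borel_measurable (lborel \<Otimes>\<^sub>M lborel_subspace H)"
      by (rule measurable_compose[OF measurable_snd]) measurable
    then have [measurable]: "Measurable.pred (lborel \<Otimes>\<^sub>M lborel_subspace H) (\<lambda>p. fst p < \<phi> (snd p))"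
      by measurable
    have ind: "indicator {y. t < \<phi> y} x = (indicator {p. fst p < \<phi> (snd p)} (t, x) :: ennreal)" for t x
      by (simp add: indicator_def)
    have "section_measure \<phi> H S = (\<integral>\<^sup>+x. (\<integral>\<^sup>+t. indicator {0<..} t * F S t x \<partial>lborel) \<partial>lborel_subspace H)"
      unfolding section_measure_def
    proof (rule nn_integral_cong)
      fix x assume "x \<in> space (lborel_subspace H)"
      then have "0 \<le> \<phi> x" using phi_nonneg H_subset by auto
      have "(\<integral>\<^sup>+t. indicator {0<..} t * F S t x \<partial>lborel) = (\<integral>\<^sup>+t. indicator S x * indicator {0<..<\<phi> x} t \<partial>lborel)"
        by (intro nn_integral_cong) (auto simp: F_def indicator_def)
      also have "\<dots> = ennreal (\<phi> x) * indicator S x"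
        using \<open>0 \<le> \<phi> x\<close> by (simp add: nn_integral_cmult mult.commute)
      finally show "ennreal (\<phi> x) * indicator S x = (\<integral>\<^sup>+t. indicator {0<..} t * F S t x \<partial>lborel)" ..
    qed
    also have "\<dots> = (\<integral>\<^sup>+t. (\<integral>\<^sup>+x. indicator {0<..} t * F S t x \<partial>lborel_subspace H) \<partial>lborel)"
      by (rule Fubini') (use S' in \<open>simp add: F_def ind split_beta'\<close>)
    also have "\<dots> = (\<integral>\<^sup>+t. indicator {0<..} t * (\<integral>\<^sup>+x. F S t x \<partial>lborel_subspace H) \<partial>lborel)"
      by (intro nn_integral_cong nn_integral_cmult) measurable
    finally show ?thesis .
  qed
  have level: "(\<integral>\<^sup>+x. F ?A t x \<partial>lborel_subspace H) \<le> (\<integral>\<^sup>+x. F D t x \<partial>lborel_subspace H)" for t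
  proof -
    note f = F[OF A, of t] and h = F[OF D_borel, of t]
    have neg: "(\<lambda>x. F ?A t (- x)) \<in> borel_measurable (lborel_subspace H)"
      using measurable_compose[OF measurable_affine[OF zero, of "-1"] f] by simp
    have refl: "(\<integral>\<^sup>+x. F ?A t (- x) \<partial>lborel_subspace H) = (\<integral>\<^sup>+x. F ?A t x \<partial>lborel_subspace H)"
      using nn_integral_affine[OF f zero, of "-1"] by simp
    have "(\<integral>\<^sup>+x. F ?A t x \<partial>lborel_subspace H) * (\<integral>\<^sup>+x. F ?A t (- x) \<partial>lborel_subspace H)
        \<le> (\<integral>\<^sup>+x. F D t x \<partial>lborel_subspace H)\<^sup>2"
    proof (rule prekopa_leindler[OF f neg h])
      fix u v assume uv: "u \<in> H" "v \<in> H"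
      then have R: "u \<in> Rn n" "v \<in> Rn n" using H_subset by auto
      show "F ?A t u * F ?A t (- v) \<le> (F D t ((1 / 2) *\<^sub>R (u + v)))\<^sup>2"
      proof (cases "u \<in> ?A \<and> - v \<in> ?A \<and> t < \<phi> u \<and> t < \<phi> (- v)")
        case True
        then obtain a b where ab: "a \<in> K" "b \<in> K" "u = a - y" "- v = b - y" by blast
        from ab(4) have "v = y - b" by (metis minus_diff_eq minus_minus)
        with ab(3) have "u + v = a - b" by simp
        then have "u + v \<in> D" using ab(1,2) unfolding difference_body_def by blast
        then have "(1 / 2) *\<^sub>R (u + v) \<in> D" by (rule D_star) auto
        moreover have "min (\<phi> u) (\<phi> v) \<le> \<phi> ((1 / 2) *\<^sub>R (u + v))"
          using phi_min[OF R, of "1/2"] by (simp add: scaleR_add_right)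
        then have "t < \<phi> ((1 / 2) *\<^sub>R (u + v))" using True phi_even[OF R(2)] by auto
        ultimately have "F D t ((1 / 2) *\<^sub>R (u + v)) = 1" by (simp add: F_def)
        moreover have "F ?A t u * F ?A t (- v) \<le> 1" by (auto simp: F_def indicator_def)
        ultimately show ?thesis by simp
      next
        case False
        then have z: "F ?A t u * F ?A t (- v) = 0" by (auto simp: F_def indicator_def simp del: image_iff)
        show ?thesis by (simp only: z zero_le)
      qed
    qed
    then have "(\<integral>\<^sup>+x. F ?A t x \<partial>lborel_subspace H)\<^sup>2 \<le> (\<integral>\<^sup>+x. F D t x \<partial>lborel_subspace H)\<^sup>2"
      by (simp only: refl power2_eq_square)
    then show ?thesis by (rule ennreal_power2_le_imp_le)
  qed
  show ?thesis
    unfolding layers[OF A] layers[OF D_borel] by (intro nn_integral_mono mult_left_mono level) simp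
qed

section \<open>Positivity of the central section\<close>

abbreviation N :: "rvec measure" where "N \<equiv> lborel_subspace (Rn n)"

text \<open>The union of all dilates of the set where phi > 0 is a linear subspace: radial
  monotonicity brings two points to a common scale, quasi-concavity handles their midpoint, evenness
  the negative scalars. Since it contains a set of positive measure, it cannot be proper.\<close>

lemma phi_support_absorbing:
  assumes v: "v \<in> Rn n"
  shows "\<exists>\<delta>>0. \<phi> (\<delta> *\<^sub>R v) > 0"
proof -
  note R = subspace_scale[OF subspace_Rn] subspace_add[OF subspace_Rn] subspace_0[OF subspace_Rn]
  let ?L = "{x \<in> Rn n. \<phi> x > 0}" and ?U = "{x \<in> Rn n. \<exists>\<delta>>0. \<phi> (\<delta> *\<^sub>R x) > 0}"
  have meas: "\<phi> \<in> borel_measurable N"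
    using phi_measurable by (simp cong: measurable_cong_sets add: full.sets_lborel_subspace)
  have "?L = {x \<in> space N. \<phi> x > 0}" by simp
  also have "\<dots> \<in> sets N" using meas by measurable
  finally have L: "?L \<in> sets N" .
  have "emeasure N ?L \<noteq> 0"
  proof
    assume "emeasure N ?L = 0"
    have "emeasure (measure_with_density \<phi> (Rn n)) (Rn n) = (\<integral>\<^sup>+x. ennreal (\<phi> x) * indicator (Rn n) x \<partial>N)"
      unfolding measure_with_density_def
      using meas sets.top[of N] by (intro emeasure_density) auto
    \<comment> \<open>The crude bound by \<open>top\<close> is enough: it is integrated over a null
      set, and off that set the integrand is 0.\<close>
    also have "\<dots> \<le> (\<integral>\<^sup>+x. top * indicator ?L x \<partial>N)"
      by (intro nn_integral_mono) (auto simp: indicator_def ennreal_neg)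
    also have "\<dots> = 0" using L \<open>emeasure N ?L = 0\<close> by (simp add: nn_integral_cmult_indicator)
    finally show False using phi_nonzero by simp
  qed
  moreover have "subspace ?U"
  proof (rule subspaceI)
    have "?L \<noteq> {}" using \<open>emeasure N ?L \<noteq> 0\<close> by (metis emeasure_empty)
    then obtain x where "x \<in> Rn n" "\<phi> x > 0" by blast
    then have "\<phi> 0 > 0" using phi_star[of x 0] by simp
    then show "0 \<in> ?U" using R by (auto intro: exI[of _ 1])
  next
    fix x y assume "x \<in> ?U" "y \<in> ?U"
    then obtain a b where ab: "x \<in> Rn n" "y \<in> Rn n" "a > 0" "b > 0" "\<phi> (a *\<^sub>R x) > 0" "\<phi> (b *\<^sub>R y) > 0"
      by blast
    define d where "d = min a b"
    have d: "d > 0" using ab by (simp add: d_def)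
    have "\<phi> (a *\<^sub>R x) \<le> \<phi> ((d / a) *\<^sub>R a *\<^sub>R x)"
      using ab by (intro phi_star R) (auto simp: d_def)
    then have "\<phi> (d *\<^sub>R x) > 0" using ab by simp
    moreover have "\<phi> (b *\<^sub>R y) \<le> \<phi> ((d / b) *\<^sub>R b *\<^sub>R y)"
      using ab by (intro phi_star R) (auto simp: d_def)
    then have "\<phi> (d *\<^sub>R y) > 0" using ab by simp
    moreover have "min (\<phi> (d *\<^sub>R x)) (\<phi> (d *\<^sub>R y)) \<le> \<phi> ((1 - 1 / 2) *\<^sub>R d *\<^sub>R x + (1 / 2) *\<^sub>R d *\<^sub>R y)"
      using ab by (intro phi_min R) auto
    moreover have "(1 - 1 / 2) *\<^sub>R d *\<^sub>R x + (1 / 2) *\<^sub>R d *\<^sub>R y = (d / 2) *\<^sub>R (x + y)"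
      by (simp add: scaleR_add_right)
    ultimately have "\<phi> ((d / 2) *\<^sub>R (x + y)) > 0" by simp
    then show "x + y \<in> ?U" using ab d R by (auto intro!: exI[of _ "d / 2"])
  next
    fix c x assume "x \<in> ?U"
    then obtain a where a: "x \<in> Rn n" "a > 0" "\<phi> (a *\<^sub>R x) > 0" by blast
    have "\<exists>\<delta>>0. \<phi> (\<delta> *\<^sub>R c *\<^sub>R x) > 0"
    proof (cases "c = 0")
      case True
      have "\<phi> (a *\<^sub>R x) \<le> \<phi> (0 *\<^sub>R a *\<^sub>R x)" using a by (intro phi_star R) auto
      then show ?thesis using True a by (intro exI[of _ 1]) simp
    next
      case False
      have "\<phi> ((a / \<bar>c\<bar>) *\<^sub>R c *\<^sub>R x) = \<phi> (a *\<^sub>R x)"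
      proof (cases "c > 0")
        case False
        with \<open>c \<noteq> 0\<close> show ?thesis using phi_even[of "a *\<^sub>R x"] a R by simp
      qed simp
      then show ?thesis using a \<open>c \<noteq> 0\<close> by (intro exI[of _ "a / \<bar>c\<bar>"]) simp
    qed
    then show "c *\<^sub>R x \<in> ?U" using a R by blast
  qed
  moreover have "?L \<subseteq> ?U" by (auto intro: exI[of _ 1])
  ultimately have "Rn n \<subseteq> ?U" using full.emeasure_proper_subspace[OF L] by blast
  then show ?thesis using v by blast
qed

text \<open>Both K - K and the set where phi > 0 contain all sufficiently small multiples of any
  given vector, so their common part in \<open>H\<close> is absorbing.\<close>

lemma section_measure_nonzero: "section_measure \<phi> H D \<noteq> 0"
proof
  assume "section_measure \<phi> H D = 0"
  let ?S = "{x \<in> space (lborel_subspace H). ennreal (\<phi> x) * indicator D x \<noteq> 0}"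
  have S: "?S \<in> sets (lborel_subspace H)" by measurable
  have "emeasure (lborel_subspace H) ?S = 0"
    using \<open>section_measure \<phi> H D = 0\<close> unfolding section_measure_def
    by (subst (asm) nn_integral_0_iff) auto
  moreover have "emeasure (lborel_subspace H) ?S \<noteq> 0"
  proof (rule emeasure_absorbing_nonzero[OF S])
    fix v assume "v \<in> H"
    then have v: "v \<in> Rn n" using H_subset by blast
    obtain \<delta> where \<delta>: "\<delta> > 0" "\<phi> (\<delta> *\<^sub>R v) > 0" using phi_support_absorbing[OF v] by blast
    obtain k \<epsilon> where k: "k \<in> K" "\<epsilon> > 0" "\<And>v. v \<in> Rn n \<Longrightarrow> norm v < \<epsilon> \<Longrightarrow> k + v \<in> K"
      using K_interior by blast
    \<comment> \<open>Below \<open>\<delta>\<close> the density stays positive by radial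
      monotonicity; below the second bound the multiple of \<open>v\<close> is shorter than
      \<open>\<epsilon>\<close> and hence lies in K - K. The added 1 covers v = 0.\<close>
    define e where "e = min \<delta> (\<epsilon> / (norm v + 1))"
    have "e > 0" using \<delta> k by (simp add: e_def add_nonneg_pos)
    then obtain j where j: "1 / real (Suc j) < e" using nat_approx_posE by blast
    let ?s = "1 / real (Suc j)"
    have "0 < ?s" by simp
    have "\<phi> (\<delta> *\<^sub>R v) \<le> \<phi> ((?s / \<delta>) *\<^sub>R \<delta> *\<^sub>R v)"
    proof (intro phi_star subspace_scale[OF subspace_Rn] v)
      show "?s / \<delta> \<le> 1"
        by (subst divide_le_eq_1_pos) (use \<delta> j in \<open>auto simp: e_def\<close>)
    qed (use \<delta> in simp)
    then have "\<phi> (?s *\<^sub>R v) > 0" using \<delta> by simp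
    moreover have "?s *\<^sub>R v \<in> D"
    proof -
      have "norm (?s *\<^sub>R v) = ?s * norm v" by simp
      also have "\<dots> \<le> ?s * (norm v + 1)" by (intro mult_left_mono) auto
      also have "\<dots> < \<epsilon>"
      proof -
        have "?s < \<epsilon> / (norm v + 1)" using j by (simp add: e_def)
        then show ?thesis by (simp add: less_divide_eq add_nonneg_pos)
      qed
      finally have "k + ?s *\<^sub>R v \<in> K" using v by (intro k(3) subspace_scale[OF subspace_Rn])
      then have "(k + ?s *\<^sub>R v) - k \<in> D" using k(1) unfolding difference_body_def by blast
      then show ?thesis by simp
    qed
    ultimately have "?s *\<^sub>R v \<in> ?S"
      using \<open>v \<in> H\<close> subspace_H by (auto simp: indicator_def ennreal_eq_0_iff intro: subspace_scale)
    then show "\<exists>j::nat. j > 0 \<and> (1 / real j) *\<^sub>R v \<in> ?S" by blast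
  qed
  ultimately show False by simp
qed

section \<open>The upper bound: the volume of K intersected with its translates\<close>

lemma K_in_sets: "K \<in> sets N"
  using full.Int_borel_in_sets[OF K_borel] K_subset by (simp add: Int_absorb2)

lemma volume_finite: "emeasure N K < \<infinity>"
  using full.emeasure_bounded_finite[OF K_in_sets] compact_imp_bounded[OF K_compact] by simp

text \<open>Moving an interior point of \<open>K\<close> to the origin preserves the volume and
  turns \<open>K\<close> into an absorbing set.\<close>

lemma volume_nonzero: "emeasure N K \<noteq> 0"
proof -
  obtain k \<epsilon> where k: "k \<in> K" "\<epsilon> > 0" "\<And>v. v \<in> Rn n \<Longrightarrow> norm v < \<epsilon> \<Longrightarrow> k + v \<in> K"
    using K_interior by blast
  have kR: "k \<in> Rn n" using k K_subset by blast
  let ?A = "(\<lambda>x. k + 1 *\<^sub>R x) -` K \<inter> space N"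
  have A: "?A \<in> sets N"
    by (rule measurable_sets[OF full.measurable_affine[OF kR] K_in_sets])
  have "emeasure N K = (\<integral>\<^sup>+x. indicator K x \<partial>N)" using K_in_sets by simp
  also have "\<dots> = ennreal (\<bar>1\<bar> ^ dim (Rn n)) * (\<integral>\<^sup>+x. indicator K (k + 1 *\<^sub>R x) \<partial>N)"
    by (rule full.nn_integral_affine[OF _ kR]) (use K_in_sets in auto)
  also have "\<dots> = (\<integral>\<^sup>+x. indicator ?A x \<partial>N)"
    by (simp, intro nn_integral_cong) (auto simp: indicator_def)
  also have "\<dots> = emeasure N ?A" using A by simp
  also have "\<dots> \<noteq> 0"
  proof (rule full.emeasure_absorbing_nonzero[OF A])
    fix v assume v: "v \<in> Rn n"
    have "\<epsilon> / (norm v + 1) > 0" using k by (simp add: add_nonneg_pos)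
    then obtain j where j: "1 / real (Suc j) < \<epsilon> / (norm v + 1)" using nat_approx_posE by blast
    let ?s = "1 / real (Suc j)"
    have "norm (?s *\<^sub>R v) = ?s * norm v" by simp
    also have "\<dots> \<le> ?s * (norm v + 1)" by (intro mult_left_mono) auto
    also have "\<dots> < \<epsilon>" using j by (simp add: less_divide_eq add_nonneg_pos)
    finally have "k + ?s *\<^sub>R v \<in> K" using v by (intro k(3) subspace_scale[OF subspace_Rn])
    then have "?s *\<^sub>R v \<in> ?A" using v by (simp add: subspace_scale[OF subspace_Rn])
    then show "\<exists>j::nat. j > 0 \<and> (1 / real j) *\<^sub>R v \<in> ?A" by blast
  qed
  finally show ?thesis .
qed

text \<open>The n-dimensional volume of the intersection of K and K - x, although x will run only
  through \<open>H\<close>. The product of indicators is the form in which the order of integration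
  can be exchanged.\<close>

definition covariogram :: "rvec \<Rightarrow> ennreal"
  where "covariogram x = (\<integral>\<^sup>+z. indicator K z * indicator K (z + x) \<partial>N)"

lemma shift_measurable:
  assumes "x \<in> Rn n" shows "(\<lambda>z. indicator K (z + x) :: ennreal) \<in> borel_measurable N"
  using measurable_compose[OF full.measurable_affine[OF assms, of 1] borel_measurable_indicator[OF K_in_sets]]
  by (simp add: add.commute)

text \<open>An upper bound suffices for the covariogram estimate, because powers of 1 - t decrease
  with the exponent.\<close>

lemma dim_Rn_le: "dim (Rn n) \<le> n"
proof -
  have "full.basis \<subseteq> Rn n" using span_superset[of full.basis] by (simp only: full.basis_props(4))
  then show ?thesis
    using independent_Rn_bound[OF orthonormal_independent[OF full.basis_props(1)]]
    by (simp only: full.basis_props(3)[symmetric])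
qed

lemma covariogram_ge:
  assumes a: "a \<in> K" and b: "b \<in> K" and t: "0 \<le> t" "t < 1"
  shows "ennreal ((1 - t) ^ n) * emeasure N K \<le> covariogram (t *\<^sub>R (a - b))"
proof -
  let ?x = "t *\<^sub>R (a - b)"
  have R: "t *\<^sub>R b \<in> Rn n" "?x \<in> Rn n"
    using a b K_subset subspace_Rn by (auto intro!: subspace_scale subspace_diff)
  have "(1 - t) ^ n \<le> (1 - t) ^ dim (Rn n)"
    using t dim_Rn_le by (intro power_decreasing) auto
  then have "ennreal ((1 - t) ^ n) * emeasure N K \<le> ennreal (\<bar>1 - t\<bar> ^ dim (Rn n)) * (\<integral>\<^sup>+z. indicator K z \<partial>N)"
    using t K_in_sets by (intro mult_mono ennreal_leI) auto
  also have "\<dots> \<le> ennreal (\<bar>1 - t\<bar> ^ dim (Rn n)) *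
      (\<integral>\<^sup>+z. indicator K (t *\<^sub>R b + (1 - t) *\<^sub>R z) * indicator K (t *\<^sub>R b + (1 - t) *\<^sub>R z + ?x) \<partial>N)"
  proof (intro mult_left_mono nn_integral_mono)
    fix z
    have shift: "t *\<^sub>R b + (1 - t) *\<^sub>R z + ?x = (1 - t) *\<^sub>R z + t *\<^sub>R a"
      by (simp add: scaleR_diff_right)
    have mem: "(1 - t) *\<^sub>R z + t *\<^sub>R c \<in> K" if "z \<in> K" "c \<in> K" for c
      using K_convex that t by (simp add: convexD_alt)
    show "(indicator K z :: ennreal) \<le>
        indicator K (t *\<^sub>R b + (1 - t) *\<^sub>R z) * indicator K (t *\<^sub>R b + (1 - t) *\<^sub>R z + ?x)"
    proof (cases "z \<in> K")
      case True
      have "t *\<^sub>R b + (1 - t) *\<^sub>R z \<in> K" using mem[OF True b] by (simp only: add.commute)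
      then show ?thesis unfolding shift using mem[OF True a] True by simp
    qed simp
  qed simp
  also have "\<dots> = covariogram ?x"
    unfolding covariogram_def
    by (rule full.nn_integral_affine[symmetric, OF _ R(1)])
      (use t K_in_sets shift_measurable[OF R(2)] in auto)
  finally show ?thesis .
qed

text \<open>For fixed x, let s be the infimum of the t in (0,1) with x in t(K - K). The weights
  integrate over [s,1] to (1 - s)^n, which times |K| is still at most the covariogram. Writing the
  estimate as an integral over t prepares the exchange with the integral over \<open>H\<close>
  without introducing a gauge function.\<close>

lemma covariogram_ge_layers:
  assumes "n \<ge> 1"
  shows "emeasure N K * (\<integral>\<^sup>+t. ennreal (real n * (1 - t) ^ (n - 1)) * indicator {0<..<1} t *
      indicator D ((1 / t) *\<^sub>R x) \<partial>lborel) \<le> covariogram x"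
proof (cases "covariogram x = top")
  case False
  let ?T = "{t. 0 < t \<and> t < 1 \<and> (1 / t) *\<^sub>R x \<in> D}"
  obtain g where g: "covariogram x = ennreal g" "g \<ge> 0" using False by (cases "covariogram x") auto
  obtain k where k: "emeasure N K = ennreal k" "k \<ge> 0"
    using volume_finite by (cases "emeasure N K") auto
  show ?thesis
  proof (cases "?T = {}")
    case True
    then have "(\<integral>\<^sup>+t. ennreal (real n * (1 - t) ^ (n - 1)) * indicator {0<..<1} t *
      indicator D ((1 / t) *\<^sub>R x) \<partial>lborel) = (\<integral>\<^sup>+t. 0 \<partial>(lborel :: real measure))"
      by (intro nn_integral_cong) (auto simp: indicator_def)
    then show ?thesis by simp
  next
    case False
    define s where "s = Inf ?T"
    have bdd: "bdd_below ?T" by (rule bdd_belowI[of _ 0]) auto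
    obtain t0 where "t0 \<in> ?T" using False by blast
    have s: "0 \<le> s" "s \<le> 1"
    proof -
      show "0 \<le> s" unfolding s_def using False by (intro cInf_greatest) auto
      have "s \<le> t0" unfolding s_def using \<open>t0 \<in> ?T\<close> bdd by (rule cInf_lower)
      then show "s \<le> 1" using \<open>t0 \<in> ?T\<close> by auto
    qed
    have le: "k * (1 - t) ^ n \<le> g" if "t \<in> ?T" for t
    proof -
      have t: "0 < t" "t < 1" "(1 / t) *\<^sub>R x \<in> D" using that by auto
      then obtain a b where ab: "a \<in> K" "b \<in> K" "(1 / t) *\<^sub>R x = a - b"
        unfolding difference_body_def by blast
      have "x = t *\<^sub>R (a - b)" using t by (simp flip: ab(3))
      then have "ennreal ((1 - t) ^ n) * ennreal k \<le> ennreal g"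
        using covariogram_ge[OF ab(1,2), of t] t g k by simp
      then show ?thesis using t k g by (simp add: mult.commute flip: ennreal_mult)
    qed
    \<comment> \<open>The infimum need not be attained (for x = 0 it is 0), so the estimate reaches
      \<open>s\<close> by continuity.\<close>
    have "k * (1 - s) ^ n \<le> g"
      unfolding s_def
      by (rule continuous_le_on_closure[where S = ?T and f = "\<lambda>t. k * (1 - t) ^ n"])
        (use le closure_contains_Inf[OF False bdd] in \<open>auto intro!: continuous_intros\<close>)
    have "(\<integral>\<^sup>+t. ennreal (real n * (1 - t) ^ (n - 1)) * indicator {0<..<1} t *
        indicator D ((1 / t) *\<^sub>R x) \<partial>lborel)
      \<le> (\<integral>\<^sup>+t. ennreal (real n * (1 - t) ^ (n - 1)) * indicator {s..1} t \<partial>lborel)"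
    proof (intro nn_integral_mono)
      fix t
      have "s \<le> t" if "t \<in> ?T" unfolding s_def using that bdd by (rule cInf_lower)
      then show "ennreal (real n * (1 - t) ^ (n - 1)) * indicator {0<..<1} t * indicator D ((1 / t) *\<^sub>R x)
        \<le> ennreal (real n * (1 - t) ^ (n - 1)) * indicator {s..1} t"
        by (auto simp: indicator_def)
    qed
    also have "\<dots> = ennreal (- ((1 - 1) ^ n) - (- ((1 - s) ^ n)))"
      by (rule nn_integral_FTC_Icc[where F = "\<lambda>t. - ((1 - t) ^ n)"])
        (use s in \<open>auto intro!: derivative_eq_intros\<close>)
    \<comment> \<open>Here n >= 1 matters: the boundary term 0^n vanishes.\<close>
    also have "\<dots> = ennreal ((1 - s) ^ n)" using assms by (simp add: power_0_left)
    finally have "emeasure N K * (\<integral>\<^sup>+t. ennreal (real n * (1 - t) ^ (n - 1)) * indicator {0<..<1} t *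
        indicator D ((1 / t) *\<^sub>R x) \<partial>lborel) \<le> ennreal k * ennreal ((1 - s) ^ n)"
      unfolding k by (intro mult_left_mono) auto
    also have "\<dots> = ennreal (k * (1 - s) ^ n)" using k s by (simp add: ennreal_mult)
    also have "\<dots> \<le> ennreal g" using \<open>k * (1 - s) ^ n \<le> g\<close> by (rule ennreal_leI)
    finally show ?thesis by (simp add: g)
  qed
qed simp

lemma integral_covariogram_le:
  "(\<integral>\<^sup>+x. ennreal (\<phi> x) * covariogram x \<partial>lborel_subspace H)
    \<le> emeasure N K * (SUP y\<in>Rn n. section_measure \<phi> H ((\<lambda>x. x - y) ` K))"
proof -
  let ?S = "SUP y\<in>Rn n. section_measure \<phi> H ((\<lambda>x. x - y) ` K)"
  let ?P = "N \<Otimes>\<^sub>M lborel_subspace H"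
  interpret pair_sigma_finite N "lborel_subspace H"
    by (intro pair_sigma_finite.intro sigma_finite full.sigma_finite)
  \<comment> \<open>The factors carry the sigma-algebras of the subspaces, so the projections become
    Borel maps into \<open>rvec\<close> only after composition with the inclusions.\<close>
  have id_N: "(\<lambda>z. z) \<in> borel_measurable N" by (rule full.measurable_from_borel) simp
  have id_H: "(\<lambda>x. x) \<in> borel_measurable (lborel_subspace H)" by (rule measurable_from_borel) simp
  have [measurable]: "fst \<in> borel_measurable ?P"
    by (rule measurable_compose[OF measurable_fst id_N])
  have [measurable]: "snd \<in> borel_measurable ?P"
    by (rule measurable_compose[OF measurable_snd id_H])
  have [measurable]: "(\<lambda>p. ennreal (\<phi> (snd p))) \<in> borel_measurable ?P"
    by (rule measurable_compose[OF measurable_snd]) measurable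
  have ind: "(\<lambda>p. indicator K (f p) :: ennreal) \<in> borel_measurable ?P"
    if "f \<in> borel_measurable ?P" for f :: "rvec \<times> rvec \<Rightarrow> rvec"
    using that by measurable
  have meas: "(\<lambda>p. ennreal (\<phi> (snd p)) * (indicator K (fst p) * indicator K (fst p + snd p))) \<in> borel_measurable ?P"
    by (intro borel_measurable_times_ennreal ind) measurable
  have "(\<integral>\<^sup>+x. ennreal (\<phi> x) * covariogram x \<partial>lborel_subspace H)
      = (\<integral>\<^sup>+x. (\<integral>\<^sup>+z. ennreal (\<phi> x) * (indicator K z * indicator K (z + x)) \<partial>N) \<partial>lborel_subspace H)"
    unfolding covariogram_def
  proof (intro nn_integral_cong)
    fix x assume "x \<in> space (lborel_subspace H)"
    then have "x \<in> Rn n" using H_subset by auto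
    then show "ennreal (\<phi> x) * (\<integral>\<^sup>+z. indicator K z * indicator K (z + x) \<partial>N)
        = (\<integral>\<^sup>+z. ennreal (\<phi> x) * (indicator K z * indicator K (z + x)) \<partial>N)"
      using K_in_sets by (intro nn_integral_cmult[symmetric] borel_measurable_times_ennreal shift_measurable) auto
  qed
  also have "\<dots> = (\<integral>\<^sup>+z. (\<integral>\<^sup>+x. ennreal (\<phi> x) * (indicator K z * indicator K (z + x)) \<partial>lborel_subspace H) \<partial>N)"
    by (rule Fubini') (use meas in \<open>simp add: split_beta'\<close>)
  also have "\<dots> \<le> (\<integral>\<^sup>+z. ?S * indicator K z \<partial>N)"
  proof (intro nn_integral_mono)
    fix z
    show "(\<integral>\<^sup>+x. ennreal (\<phi> x) * (indicator K z * indicator K (z + x)) \<partial>lborel_subspace H) \<le> ?S * indicator K z"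
    proof (cases "z \<in> K")
      case True
      \<comment> \<open>For z in K the admissible x form the translate K - z, which competes in the
        supremum with y = z.\<close>
      have "indicator K (z + x) = (indicator ((\<lambda>x. x - z) ` K) x :: ennreal)" for x
        by (force simp: indicator_def image_iff)
      then have "(\<integral>\<^sup>+x. ennreal (\<phi> x) * (indicator K z * indicator K (z + x)) \<partial>lborel_subspace H)
          = section_measure \<phi> H ((\<lambda>x. x - z) ` K)"
        using True by (simp add: section_measure_def)
      also have "\<dots> \<le> ?S" using True K_subset by (intro SUP_upper) auto
      finally show ?thesis using True by simp
    qed simp
  qed
  also have "\<dots> = emeasure N K * ?S" 
    unfolding mult.commute[of "emeasure N K"] by (rule nn_integral_cmult_indicator[OF K_in_sets])
  finally show ?thesis .
qed

lemma integral_covariogram_ge: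
  assumes "n \<ge> 1"
  shows "emeasure N K * (ennreal (1 / real ((n + dim H) choose dim H)) * section_measure \<phi> H D)
    \<le> (\<integral>\<^sup>+x. ennreal (\<phi> x) * covariogram x \<partial>lborel_subspace H)"
proof -
  \<comment> \<open>Layer weights: \<open>(1 - s)^n\<close> is the integral of \<open>w\<close> over \<open>[s, 1]\<close>.\<close>
  define w where "w = (\<lambda>t. ennreal (real n * (1 - t) ^ (n - 1)) * indicator {0<..<1} t)"
  have w[measurable]: "w \<in> borel_measurable borel" unfolding w_def by measurable
  let ?P = "lborel \<Otimes>\<^sub>M lborel_subspace H"
  interpret pair_sigma_finite lborel "lborel_subspace H"
    by (intro pair_sigma_finite.intro sigma_finite lborel.sigma_finite_measure_axioms)
  have zero: "0 \<in> H" using subspace_H by (rule subspace_0)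
  have id_H: "(\<lambda>x. x) \<in> borel_measurable (lborel_subspace H)" by (rule measurable_from_borel) simp
  have [measurable]: "snd \<in> borel_measurable ?P"
    by (rule measurable_compose[OF measurable_snd id_H])
  have [measurable]: "(\<lambda>p. ennreal (\<phi> (snd p))) \<in> borel_measurable ?P"
    by (rule measurable_compose[OF measurable_snd]) measurable
  have "(\<lambda>p. (1 / fst p) *\<^sub>R snd p) \<in> borel_measurable ?P" by measurable
  from measurable_compose[OF this borel_measurable_indicator[OF D_borel]]
  have [measurable]: "(\<lambda>p. indicator D ((1 / fst p) *\<^sub>R snd p) :: ennreal) \<in> borel_measurable ?P" .
  have layer_measurable [measurable]:
    "(\<lambda>x. \<integral>\<^sup>+t. w t * indicator D ((1 / t) *\<^sub>R x) \<partial>lborel) \<in> borel_measurable (lborel_subspace H)"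
  proof (rule lborel.borel_measurable_nn_integral)
    let ?Q = "lborel_subspace H \<Otimes>\<^sub>M (lborel :: real measure)"
    have [measurable]: "fst \<in> borel_measurable ?Q"
      by (rule measurable_compose[OF measurable_fst id_H])
    have "(\<lambda>p. (1 / snd p) *\<^sub>R fst p) \<in> borel_measurable ?Q" by measurable
    from measurable_compose[OF this borel_measurable_indicator[OF D_borel]]
    have [measurable]: "(\<lambda>p. indicator D ((1 / snd p) *\<^sub>R fst p) :: ennreal) \<in> borel_measurable ?Q" .
    show "(\<lambda>(x, t). w t * indicator D ((1 / t) *\<^sub>R x)) \<in> borel_measurable ?Q"
      unfolding split_beta' by measurable
  qed
  have scaled: "(\<lambda>x. indicator D (s *\<^sub>R x) :: ennreal) \<in> borel_measurable (lborel_subspace H)" for s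
    using measurable_compose[OF measurable_affine[OF zero, of s] indicator_measurable_H[OF D_borel]] by simp
  have inner: "w t * (ennreal (t ^ dim H) * section_measure \<phi> H D)
      \<le> w t * (\<integral>\<^sup>+x. ennreal (\<phi> x) * indicator D ((1 / t) *\<^sub>R x) \<partial>lborel_subspace H)" for t
  proof (cases "0 < t \<and> t < 1")
    case True
    \<comment> \<open>The substitution of t x for x turns membership in t(K - K) into membership in
      K - K, so only the two values of phi remain to be compared.\<close>
    have "ennreal (t ^ dim H) * section_measure \<phi> H D
        \<le> ennreal (\<bar>t\<bar> ^ dim H) * (\<integral>\<^sup>+x. ennreal (\<phi> (0 + t *\<^sub>R x)) * indicator D ((1 / t) *\<^sub>R (0 + t *\<^sub>R x)) \<partial>lborel_subspace H)"
      unfolding section_measure_def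
      using True H_subset by (intro mult_mono nn_integral_mono ennreal_leI) (auto intro!: phi_star)
    also have "\<dots> = (\<integral>\<^sup>+x. ennreal (\<phi> x) * indicator D ((1 / t) *\<^sub>R x) \<partial>lborel_subspace H)"
      using True by (intro nn_integral_affine[symmetric] zero borel_measurable_times_ennreal scaled) auto
    finally show ?thesis by (rule mult_left_mono) simp
  qed (simp add: w_def)
  have "emeasure N K * (ennreal (1 / real ((n + dim H) choose dim H)) * section_measure \<phi> H D)
      = emeasure N K * (\<integral>\<^sup>+t. w t * (ennreal (t ^ dim H) * section_measure \<phi> H D) \<partial>lborel)"
    unfolding nn_integral_beta_binomial[OF assms, symmetric] w_def
    by (subst nn_integral_multc[symmetric]) (auto simp: mult.assoc)
  also have "\<dots> \<le> emeasure N K * (\<integral>\<^sup>+t. w t * (\<integral>\<^sup>+x. ennreal (\<phi> x) * indicator D ((1 / t) *\<^sub>R x) \<partial>lborel_subspace H) \<partial>lborel)"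
    by (intro mult_left_mono nn_integral_mono inner) simp
  also have "\<dots> = emeasure N K * (\<integral>\<^sup>+t. (\<integral>\<^sup>+x. w t * (ennreal (\<phi> x) * indicator D ((1 / t) *\<^sub>R x)) \<partial>lborel_subspace H) \<partial>lborel)"
    by (intro arg_cong2[where f = "(*)"] nn_integral_cong nn_integral_cmult[symmetric] borel_measurable_times_ennreal scaled) auto
  also have "\<dots> = emeasure N K * (\<integral>\<^sup>+x. (\<integral>\<^sup>+t. w t * (ennreal (\<phi> x) * indicator D ((1 / t) *\<^sub>R x)) \<partial>lborel) \<partial>lborel_subspace H)"
    by (subst Fubini') (simp_all add: split_beta')
  also have "\<dots> = emeasure N K * (\<integral>\<^sup>+x. ennreal (\<phi> x) * (\<integral>\<^sup>+t. w t * indicator D ((1 / t) *\<^sub>R x) \<partial>lborel) \<partial>lborel_subspace H)"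
    by (subst nn_integral_cmult[symmetric]) (auto simp: mult_ac)
  also have "\<dots> \<le> (\<integral>\<^sup>+x. emeasure N K * (ennreal (\<phi> x) * (\<integral>\<^sup>+t. w t * indicator D ((1 / t) *\<^sub>R x) \<partial>lborel)) \<partial>lborel_subspace H)"
    by (subst nn_integral_cmult) auto
  also have "\<dots> \<le> (\<integral>\<^sup>+x. ennreal (\<phi> x) * covariogram x \<partial>lborel_subspace H)"
  proof (intro nn_integral_mono)
    fix x
    show "emeasure N K * (ennreal (\<phi> x) * (\<integral>\<^sup>+t. w t * indicator D ((1 / t) *\<^sub>R x) \<partial>lborel)) \<le> ennreal (\<phi> x) * covariogram x"
      using covariogram_ge_layers[OF assms, of x]
      by (subst mult.left_commute) (auto simp: w_def intro!: mult_left_mono)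
  qed
  finally show ?thesis .
qed

text \<open>The volume of \<open>K\<close> is finite and positive and cancels from the two
  covariogram estimates. The remaining care is that numerator and denominator are positive reals,
  since otherwise \<open>enn2real\<close> would return its default value.\<close>

lemma section_ratio_bounds:
  assumes "n \<ge> 1"
  shows "1 \<le> section_ratio n \<phi> H K" "section_ratio n \<phi> H K \<le> real ((n + dim H) choose dim H)"
proof -
  let ?S = "SUP y\<in>Rn n. section_measure \<phi> H ((\<lambda>x. x - y) ` K)"
  let ?c = "real ((n + dim H) choose dim H)"
  have c: "?c > 0" by simp
  obtain p where p: "section_measure \<phi> H D = ennreal p" "p > 0"
    using section_measure_finite section_measure_nonzero
    by (cases "section_measure \<phi> H D") (auto simp: ennreal_eq_0_iff not_le)
  have S_le: "?S \<le> ennreal p"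
    unfolding p(1)[symmetric] by (intro SUP_least section_measure_le_difference)
  then have "?S \<noteq> top" by (metis ennreal_neq_top top_unique)
  then obtain s where s: "?S = ennreal s" "s \<ge> 0" by (cases ?S) auto
  obtain k where k: "emeasure N K = ennreal k" "k > 0"
    using volume_finite volume_nonzero by (cases "emeasure N K") (auto simp: ennreal_eq_0_iff not_le)
  have "emeasure N K * (ennreal (1 / ?c) * section_measure \<phi> H D) \<le> emeasure N K * ?S"
    using integral_covariogram_ge[OF assms] integral_covariogram_le by (rule order_trans)
  then have "ennreal (k * (1 / ?c * p)) \<le> ennreal (k * s)"
    using p s k c by (simp only: ennreal_mult'[symmetric] less_imp_le zero_le_divide_1_iff of_nat_0_le_iff)
  then have "k * (1 / ?c * p) \<le> k * s"
    using k s by (subst (asm) ennreal_le_iff) auto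
  then have le: "p \<le> ?c * s" using k c by (simp add: field_simps)
  \<comment> \<open>The upper bound itself shows that the denominator is not zero.\<close>
  with p(2) have "s \<noteq> 0" by auto
  with s(2) have "s > 0" by simp
  then have ratio: "section_ratio n \<phi> H K = p / s"
    unfolding section_ratio_def p(1) s(1) using p(2) by (simp add: divide_ennreal)
  have "s \<le> p" using S_le s p by simp
  then show "1 \<le> section_ratio n \<phi> H K" unfolding ratio using \<open>s > 0\<close> by simp
  show "section_ratio n \<phi> H K \<le> ?c" unfolding ratio using le \<open>s > 0\<close> by (simp add: divide_le_eq)
qed

end

theorem theorem6:
  shows "\<exists>C::real. C > 1 \<and>
    (\<forall>(n::nat) (m::nat) (\<phi> :: rvec \<Rightarrow> real) (H :: rvec set) (K :: rvec set).
      1 \<le> m \<and> m \<le> n \<and>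
      \<phi> \<in> borel_measurable (restrict_space borel (Rn n)) \<and>
      bounded (\<phi> ` Rn n) \<and>
      (\<forall>x\<in>Rn n. \<phi> (- x) = \<phi> x) \<and>
      quasi_concave_on (Rn n) \<phi> \<and>
      emeasure (measure_with_density \<phi> (Rn n)) (Rn n) \<noteq> 0 \<and>
      subspace H \<and> H \<subseteq> Rn n \<and> dim H = m \<and>
      convex_body n K
      \<longrightarrow>
      1 \<le> section_ratio n \<phi> H K powr (1 / real m) \<and>
      section_ratio n \<phi> H K powr (1 / real m) \<le> real ((n + m) choose m) powr (1 / real m) \<and>
      real ((n + m) choose m) powr (1 / real m) \<le> C * (real n / real m))"
proof (intro exI[of _ "2 * exp 1 :: real"] conjI allI impI; (elim conjE)?)
  show "2 * exp 1 > (1 :: real)" using exp_gt_one[of 1] by linarith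
next
  fix n m :: nat and \<phi> :: "rvec \<Rightarrow> real" and H K :: "rvec set"
  assume m: "1 \<le> m" "m \<le> n" and phi: "\<phi> \<in> borel_measurable (restrict_space borel (Rn n))"
    "bounded (\<phi> ` Rn n)" "\<forall>x\<in>Rn n. \<phi> (- x) = \<phi> x" "quasi_concave_on (Rn n) \<phi>"
    "emeasure (measure_with_density \<phi> (Rn n)) (Rn n) \<noteq> 0"
    and H: "subspace H" "H \<subseteq> Rn n" "dim H = m" and K: "convex_body n K"
  interpret symmetric_section n H \<phi> K
    by unfold_locales (use phi H K in auto)
  have ratio: "1 \<le> section_ratio n \<phi> H K" "section_ratio n \<phi> H K \<le> real ((n + m) choose m)"
    using section_ratio_bounds m H(3) by auto
  show "1 \<le> section_ratio n \<phi> H K powr (1 / real m)"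
    using ratio(1) by (intro ge_one_powr_ge_zero) auto
  show "section_ratio n \<phi> H K powr (1 / real m) \<le> real ((n + m) choose m) powr (1 / real m)"
    using ratio by (intro powr_mono2) auto
  show "real ((n + m) choose m) powr (1 / real m) \<le> 2 * exp 1 * (real n / real m)"
    using m by (rule binomial_root_le)
qed

end
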